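(* Consider a stochastic $K$-armed bandit ($K\ge 2$) whose arm reward distributions $\nu_1,\dots,\nu_K$ are supported on $[0,1]$, with means ordered $\mu_1\ge\mu_2\ge\cdots\ge\mu_K$, run with the KL-MS algorithm for $T$ rounds. Then for any $\Delta\ge 0$ and any $c\in(0,\tfrac14]$, \[ \mathrm{Reg}(T)\le T\Delta+\sum_{a:\Delta_a>\Delta}\frac{\Delta_a\ln\big(T\,\mathsf{kl}(\mu_a+c\Delta_a,\mu_1-c\Delta_a)\vee e^2\big)}{\mathsf{kl}(\mu_a+c\Delta_a,\mu_1-c\Delta_a)} +392\sum_{a:\Delta_a>\Delta}\Big(\frac{\dot\mu_1+\Delta_a}{c^2\Delta_a}\Big)\ln\Big(\Big(\frac{\dot\mu_1+\Delta_a}{c^2\Delta_a^2}\wedge\frac{c^2T\Delta_a^2}{\dot\mu_1+\Delta_a}\Big)\vee e^2\Big). \]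
   Context: Bandit model: arm $i\in[K]=\{1,\dots,K\}$ has reward distribution $\nu_i$ supported on $[0,1]$ with mean $\mu_i$; arms are indexed so that $\mu_1\ge\cdots\ge\mu_K$ (arm 1 is optimal). At each round $t=1,\dots,T$ the learner chooses $I_t\in[K]$ and observes reward $y_t\sim\nu_{I_t}$, drawn independently of the past given $I_t$. $N_{t,a}=\sum_{s\le t}\mathbf 1\{I_s=a\}$; $\hat\mu_{t,a}=\frac{1}{N_{t,a}}\sum_{s\le t}\mathbf 1\{I_s=a\}y_s$; $\hat\mu_{t,\max}=\max_{a}\hat\mu_{t,a}$. $\Delta_a=\mu_1-\mu_a$. Pseudo-regret $\mathrm{Reg}(T)=T\mu_1-\mathbb E\sum_{t=1}^T y_t=\sum_a\Delta_a\mathbb E[N_{T,a}]$. Binary KL divergence $\mathsf{kl}(p,q)=p\ln\frac pq+(1-p)\ln\frac{1-p}{1-q}$ for $p,q\in[0,1]$ (with $0\ln 0=0$). For $\mu\in[0,1]$, $\dot\mu=\mu(1-\mu)$; in particular $\dot\mu_1=\mu_1(1-\mu_1)$. $x\vee y=\max(x,y)$, $x\wedge y=\min(x,y)$. KL-MS algorithm: for $t\le K$ pull arm $I_t=t$; for $t\ge K+1$, sample $I_t$ from the distribution $p_{t,a}=\exp\big(-N_{t-1,a}\,\mathsf{kl}(\hat\mu_{t-1,a},\hat\mu_{t-1,\max})\big)/M_t$, where $M_t=\sum_{b=1}^K\exp\big(-N_{t-1,b}\,\mathsf{kl}(\hat\mu_{t-1,b},\hat\mu_{t-1,\max})\big)$.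 *)

theory Defs
  imports "HOL-Probability.Probability"
begin

text \<open>Binary KL divergence with the convention 0 ln 0 = 0.  The value is the
mathematically correct (finite) one whenever q is in the open interval (0,1),
or whenever p = q; the case where the true divergence is infinite is handled
separately in the algorithm weights (weight 0 = exp(-infinity)).\<close>

definition kl :: "real \<Rightarrow> real \<Rightarrow> real" where
  "kl p q = (if p = 0 then 0 else p * ln (p / q))
          + (if p = 1 then 0 else (1 - p) * ln ((1 - p) / (1 - q)))"

definition kl_infinite :: "real \<Rightarrow> real \<Rightarrow> bool" where
  "kl_infinite p q \<longleftrightarrow> (q = 0 \<and> p \<noteq> 0) \<or> (q = 1 \<and> p \<noteq> 1)"

text \<open>Arms are 1..K, rounds are 1..T.  A history of the first t rounds is an
extensional function on {1..t} mapping round s to (I_s, y_s).\<close>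

type_synonym history = "nat \<Rightarrow> nat \<times> real"

definition hist_space :: "nat \<Rightarrow> history measure" where
  "hist_space t = PiM {1..t} (\<lambda>_. count_space UNIV \<Otimes>\<^sub>M borel)"

text \<open>Statistics available at the start of round t, i.e. N_{t-1,a}, hat mu_{t-1,a}.\<close>

definition npulls :: "nat \<Rightarrow> history \<Rightarrow> nat \<Rightarrow> nat" where
  "npulls t h a = card {s \<in> {1..<t}. fst (h s) = a}"

definition muhat :: "nat \<Rightarrow> history \<Rightarrow> nat \<Rightarrow> real" where
  "muhat t h a = (\<Sum>s\<in>{1..<t}. if fst (h s) = a then snd (h s) else 0) / real (npulls t h a)"

definition muhat_max :: "nat \<Rightarrow> nat \<Rightarrow> history \<Rightarrow> real" where
  "muhat_max K t h = Max (muhat t h ` {1..K})"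

definition klms_weight :: "nat \<Rightarrow> nat \<Rightarrow> history \<Rightarrow> nat \<Rightarrow> real" where
  "klms_weight K t h a =
     (if kl_infinite (muhat t h a) (muhat_max K t h) then 0
      else exp (- real (npulls t h a) * kl (muhat t h a) (muhat_max K t h)))"

definition klms_policy :: "nat \<Rightarrow> nat \<Rightarrow> history \<Rightarrow> nat measure" where
  "klms_policy K t h =
     (if t \<le> K then return (count_space UNIV) t
      else density (count_space UNIV)
             (\<lambda>a. ennreal (if a \<in> {1..K}
                            then klms_weight K t h a / (\<Sum>b\<in>{1..K}. klms_weight K t h b)
                            else 0)))"

primrec klms_hist :: "(nat \<Rightarrow> real measure) \<Rightarrow> nat \<Rightarrow> nat \<Rightarrow> history measure" where
  "klms_hist nu K 0 = return (hist_space 0) (\<lambda>_. undefined)"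
| "klms_hist nu K (Suc t) =
     klms_hist nu K t \<bind> (\<lambda>h. klms_policy K (Suc t) h \<bind>
        (\<lambda>a. distr (nu a) (hist_space (Suc t)) (\<lambda>y. h(Suc t := (a, y)))))"

definition arm_mean :: "(nat \<Rightarrow> real measure) \<Rightarrow> nat \<Rightarrow> real" where
  "arm_mean nu a = (\<integral>y. y \<partial>nu a)"

definition klms_regret :: "(nat \<Rightarrow> real measure) \<Rightarrow> nat \<Rightarrow> nat \<Rightarrow> real" where
  "klms_regret nu K T =
     real T * arm_mean nu 1 - (\<integral>h. (\<Sum>t\<in>{1..T}. snd (h t)) \<partial>klms_hist nu K T)"

end

theory Submission
  imports Defs
begin

text \<open>Fix a suboptimal arm \<open>a\<close>, put \<open>\<epsilon> = c \<Delta>\<^sub>a\<close>, \<open>q = \<mu>\<^sub>1 - \<epsilon>\<close>, \<open>p = \<mu>\<^sub>a + \<epsilon>\<close>, and count the pulls of \<open>a\<close>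
after the first \<open>m \<approx> ln (T kl(p, q)) / kl(p, q)\<close> ones.  If the maximal empirical mean is at least \<open>q\<close> and
that of arm \<open>a\<close> is at most \<open>p\<close>, the sampling probability is at most \<open>exp (- m kl(p, q))\<close>.  If the
empirical mean of \<open>a\<close> exceeds \<open>p\<close>, a Chernoff bound applies.  If the maximal empirical mean is below
\<open>q\<close>, the probability of \<open>a\<close> is at most that of arm 1 times \<open>exp (n kl(x, q))\<close>, where \<open>x \<le> q\<close> is
the mean of the first \<open>n\<close> rewards of arm 1; so it remains to sum over \<open>n\<close> the expectation of this exponential on the
event \<open>x \<le> q\<close>.  The function \<open>exp (n kl(min x q, q))\<close> is convex, hence its expectation is largest
for Bernoulli rewards, and there each binomial term equals a probability of the form
\<open>Bin(n, j/n){j} \<le> sqrt (n / (j (n - j)))\<close> times an exponential that decays in both \<open>n\<close> and \<open>nq - j\<close>.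
This yields \<open>O((\<mu>\<^sub>1 (1 - \<mu>\<^sub>1) + \<Delta>\<^sub>a) / \<epsilon>\<^sup>2)\<close> without any logarithm.\<close>

section \<open>Binary relative entropy\<close>

text \<open>Charging arm 1 removes the horizon: its n-th pull happens at most once, however the
  pulls are spread over the rounds, so each n is paid for once. The weight exp (n kl(x, q)) cancels
  most of the decay of the probability of x, so factors that are not exponential matter. For
  Bernoulli rewards kl is a log-likelihood ratio, hence the term at j equals Bin(n, j/n){j} times
  exp (- n k - s (n q - j)), where k = kl(q, \<mu>1) and s is the difference of the log odds of
  \<mu>1 and q. With V = \<mu>1 (1 - q) and \<epsilon> = \<mu>1 - q one has 1/k <= 2 V /
  \<epsilon>^2 and 1/s <= V / \<epsilon>. Bounding the first factor by 1 would give about 1 / (s k),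
  that is V^2 / \<epsilon>^3, too large by V / \<epsilon> when \<epsilon> is small. The square root
  bound supplies a factor of order 1 / sqrt (n V), and the sum drops to the order V / \<epsilon>^2.
  The condition c <= 1/4 keeps q >= 3/4 \<mu>1, so that q and \<mu>1 are comparable. Variance bounds
  along the segment between the means, rather than the universal 1/4, produce the numerator \<mu>1
  (1 - \<mu>1) + \<Delta>a.\<close>

lemma kl_self [simp]: "kl x x = 0"
  by (simp add: kl_def)

text \<open>The entropy of \<open>x\<close> cancels and leaves an affine function of
  \<open>x\<close>. The monotonicity facts below, the supporting lines in
  \<open>exp_kl_convex\<close> and the tilting in \<open>binomial_tilted_sum_le\<close> rest on
  this.\<close>

lemma kl_diff:
  assumes "x \<in> {0..1}" "a \<in> {0<..<1}" "b \<in> {0<..<1}"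
  shows "kl x b - kl x a = x * ln (a / b) + (1 - x) * ln ((1 - a) / (1 - b))"
proof (cases "x = 0 \<or> x = 1")
  case True
  then show ?thesis using assms by (auto simp: kl_def ln_div)
next
  case False
  then have "0 < x" "x < 1" using assms by auto
  then show ?thesis using assms by (simp add: kl_def ln_div algebra_simps)
qed

lemma kl_nonneg:
  assumes "x \<in> {0..1}" "a \<in> {0<..<1}"
  shows "0 \<le> kl x a"
proof -
  \<comment> \<open>This is \<open>ln u <= u - 1\<close> at \<open>u = b / y\<close>. Applied to
    both outcomes, the lower bounds are \<open>x - a\<close> and \<open>a - x\<close>, which add up
    to 0.\<close>
  have *: "y - b \<le> y * ln (y / b)" if "0 < y" "0 < b" for y b :: real
  proof -
    have "ln (b / y) \<le> b / y - 1" using that by (intro ln_le_minus_one) auto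
    then have "y * ln (b / y) \<le> y * (b / y - 1)" using that by (intro mult_left_mono) auto
    also have "\<dots> = b - y" using that by (simp add: field_simps)
    finally show ?thesis using that by (simp add: ln_div algebra_simps)
  qed
  have "x - a \<le> (if x = 0 then 0 else x * ln (x / a))"
    using assms *[of x a] by auto
  moreover have "(1 - x) - (1 - a) \<le> (if x = 1 then 0 else (1 - x) * ln ((1 - x) / (1 - a)))"
    using assms *[of "1 - x" "1 - a"] by auto
  ultimately show ?thesis unfolding kl_def by linarith
qed

text \<open>By \<open>kl_diff\<close> the difference \<open>kl x b - kl x a\<close> is affine in
  \<open>x\<close>, has slope at most 0 because \<open>a <= b\<close>, and equals
  \<open>kl a b\<close> at \<open>x = a\<close>.\<close>

lemma kl_three_point:
  assumes "x \<in> {0..1}" "a \<in> {0<..<1}" "b \<in> {0<..<1}" "x \<le> a" "a \<le> b"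
  shows "kl x a + kl a b \<le> kl x b"
proof -
  have "(a - x) * ln (a / b) \<le> 0"
    using assms by (intro mult_nonneg_nonpos) auto
  moreover have "(a - x) * ln ((1 - a) / (1 - b)) \<ge> 0"
    using assms by (intro mult_nonneg_nonneg) auto
  moreover have "kl a b = a * ln (a / b) + (1 - a) * ln ((1 - a) / (1 - b))"
    using kl_diff[of a a b] assms by auto
  ultimately show ?thesis using kl_diff[of x a b] assms by (simp add: algebra_simps)
qed

lemma kl_mono_right:
  assumes "x \<in> {0..1}" "x \<le> a" "a \<le> b" "b < 1"
  shows "kl x a \<le> kl x b"
\<comment> \<open>The value \<open>a = 0\<close>, out of reach of \<open>kl_three_point\<close>,
  forces \<open>x = 0\<close>. It occurs when every empirical mean is 0.\<close>
proof (cases "a = 0 \<or> a = b")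
  case True
  then show ?thesis using assms kl_nonneg[of x b] by (cases "b = 0") auto
next
  case False
  then have "a \<in> {0<..<1}" "b \<in> {0<..<1}" using assms by auto
  then show ?thesis using kl_three_point[of x a b] kl_nonneg[of a b] assms by auto
qed

lemma kl_antimono_left:
  assumes "x \<in> {0..1}" "a \<in> {0<..<1}" "b \<in> {0<..<1}" "x \<le> a" "a \<le> b"
  shows "kl a b \<le> kl x b"
  using kl_three_point[OF assms] kl_nonneg[of x a] assms by auto

text \<open>The derivative of \<open>kl p t\<close> in \<open>t\<close> is
  \<open>(t - p) / (t * (1 - t))\<close>, at least \<open>(t - p) / V\<close>; integrate from
  \<open>p\<close> to \<open>r\<close>. With \<open>V = 1/4\<close> this is Pinsker's inequality,
  which would lose the variance of arm 1.\<close>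

lemma kl_ge_quadratic:
  assumes "0 < p" "p \<le> r" "r < 1" "0 < V" and V: "\<And>t. p \<le> t \<Longrightarrow> t \<le> r \<Longrightarrow> t * (1 - t) \<le> V"
  shows "(r - p)\<^sup>2 / (2 * V) \<le> kl p r"
proof -
  define F where "F t = p * (ln p - ln t) + (1 - p) * (ln (1 - p) - ln (1 - t)) - (t - p)\<^sup>2 / (2 * V)" for t
  have "F p \<le> F r"
  proof (rule DERIV_nonneg_imp_nondecreasing[OF assms(2)])
    fix t assume t: "p \<le> t" "t \<le> r"
    have tp: "0 < t" "t < 1" "0 < t * (1 - t)" using t assms by auto
    have "(F has_real_derivative (- p / t + (1 - p) / (1 - t) - (t - p) / V)) (at t)"
      unfolding F_def using tp assms
      by (auto intro!: derivative_eq_intros simp: diff_divide_distrib)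
    moreover have "- p / t + (1 - p) / (1 - t) = (t - p) / (t * (1 - t))"
      using tp by (simp add: divide_simps) (simp add: algebra_simps)
    moreover have "(t - p) / V \<le> (t - p) / (t * (1 - t))"
      using tp t assms V[OF t] by (intro divide_left_mono) auto
    ultimately show "\<exists>y. (F has_real_derivative y) (at t) \<and> 0 \<le> y"
      by (intro exI[of _ "- p / t + (1 - p) / (1 - t) - (t - p) / V"]) auto
  qed
  moreover have "F p = 0" using assms by (simp add: F_def)
  moreover have "F r = kl p r - (r - p)\<^sup>2 / (2 * V)" using assms by (auto simp: F_def kl_def ln_div)
  ultimately show ?thesis by simp
qed

section \<open>Binomial probabilities at the mode\<close>

text \<open>Ratio of \<open>n!\<close> to its Stirling approximation without the constant sqrt (2
  pi). The proof works with two properties: it decreases, and it is at least 1.\<close>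

definition stirling_ratio :: "nat \<Rightarrow> real" where
  "stirling_ratio n = fact n * exp (real n) / (real n ^ n * sqrt (real n))"

text \<open>Midpoint and trapezoidal values for the integral of \<open>1 / u\<close> over
  \<open>[x, x + 1]\<close>; they enclose it because \<open>1 / u\<close> is convex. In the variable
  \<open>y = 1 / x\<close> both inequalities are equalities at 0, so derivatives decide.\<close>

lemma ln_one_plus_inverse_bounds:
  fixes x :: real assumes "0 < x"
  shows "2 / (2 * x + 1) \<le> ln ((x + 1) / x)"
    and "ln ((x + 1) / x) \<le> (2 * x + 1) / (2 * x * (x + 1))"
proof -
  define y where "y = 1 / x"
  have y: "0 < y" using assms by (simp add: y_def)
  have yx: "(x + 1) / x = 1 + y" using assms by (simp add: y_def field_simps)
  define F where "F t = ln (1 + t) - 2 * t / (2 + t)" for t :: real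
  have "F 0 \<le> F y"
  proof (rule DERIV_nonneg_imp_nondecreasing[of 0 y F])
    fix t :: real assume t: "0 \<le> t" "t \<le> y"
    have "(F has_real_derivative (1 / (1 + t) - 4 / (2 + t)\<^sup>2)) (at t)"
      unfolding F_def using t by (auto intro!: derivative_eq_intros simp: field_simps power2_eq_square)
    moreover have "4 / (2 + t)\<^sup>2 \<le> 1 / (1 + t)"
      using t by (simp add: divide_simps power2_eq_square) (simp add: algebra_simps)
    ultimately show "\<exists>z. (F has_real_derivative z) (at t) \<and> 0 \<le> z"
      by (intro exI[of _ "1 / (1 + t) - 4 / (2 + t)\<^sup>2"]) auto
  qed (use y in auto)
  then have "2 * y / (2 + y) \<le> ln (1 + y)" by (simp add: F_def)
  moreover have "2 * y / (2 + y) = 2 / (2 * x + 1)" using assms by (simp add: y_def field_simps)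
  ultimately show "2 / (2 * x + 1) \<le> ln ((x + 1) / x)" unfolding yx by simp
  define G where "G t = (t + t / (1 + t)) / 2 - ln (1 + t)" for t :: real
  have "G 0 \<le> G y"
  proof (rule DERIV_nonneg_imp_nondecreasing[of 0 y G])
    fix t :: real assume t: "0 \<le> t" "t \<le> y"
    have "(G has_real_derivative ((1 + 1 / (1 + t)\<^sup>2) / 2 - 1 / (1 + t))) (at t)"
      unfolding G_def using t
      by (auto intro!: derivative_eq_intros simp: field_simps power2_eq_square)
    moreover have "(1 + 1 / (1 + t)\<^sup>2) / 2 - 1 / (1 + t) = (1 - 1 / (1 + t))\<^sup>2 / 2"
      by (simp add: power2_diff power_one_over diff_divide_distrib add_divide_distrib)
        (simp add: divide_simps)
    ultimately show "\<exists>z. (G has_real_derivative z) (at t) \<and> 0 \<le> z"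
      by (intro exI[of _ "(1 - 1 / (1 + t))\<^sup>2 / 2"]) auto
  qed (use y in auto)
  then have "ln (1 + y) \<le> (y + y / (1 + y)) / 2" by (simp add: G_def)
  also have "(y + y / (1 + y)) / 2 = (2 * x + 1) / (2 * x * (x + 1))"
    using assms by (simp add: y_def field_simps)
  finally show "ln ((x + 1) / x) \<le> (2 * x + 1) / (2 * x * (x + 1))" unfolding yx .
qed

lemma ln_stirling_ratio:
  assumes "0 < n"
  shows "0 < stirling_ratio n" 
    "ln (stirling_ratio n) - ln (stirling_ratio (Suc n)) = (real n + 1/2) * ln ((real n + 1) / real n) - 1"
proof -
  have l: "ln (stirling_ratio m) = ln (fact m) + real m - (real m + 1/2) * ln (real m)" if "0 < m" for m
    using that by (simp add: stirling_ratio_def ln_div ln_mult ln_realpow ln_sqrt algebra_simps)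
  show "0 < stirling_ratio n" using assms by (simp add: stirling_ratio_def)
  have "ln (fact (Suc n)) = ln (fact n) + ln (real n + 1)"
    by (simp add: ln_mult add.commute)
  then show "ln (stirling_ratio n) - ln (stirling_ratio (Suc n)) = (real n + 1/2) * ln ((real n + 1) / real n) - 1"
    using l[of n] l[of "Suc n"] assms by (simp add: ln_div algebra_simps)
qed

lemma stirling_ratio_decreasing:
  assumes "0 < m" "m \<le> n" shows "stirling_ratio n \<le> stirling_ratio m"
  using assms(2)
proof (induction n rule: dec_induct)
  case base then show ?case by simp
next
  case (step n)
  then have n: "0 < n" using assms by simp
  have "2 / (2 * real n + 1) * (real n + 1/2) \<le> ln ((real n + 1) / real n) * (real n + 1/2)"
    using n by (intro mult_right_mono ln_one_plus_inverse_bounds) auto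
  moreover have "2 / (2 * real n + 1) * (real n + 1/2) = 1" by (simp add: field_simps)
  ultimately have "ln (stirling_ratio (Suc n)) \<le> ln (stirling_ratio n)"
    using ln_stirling_ratio(2)[OF n] by (simp add: algebra_simps)
  then show ?case using step ln_stirling_ratio(1)[of n] ln_stirling_ratio(1)[of "Suc n"] n by auto
qed

lemma stirling_ratio_ge_1:
  assumes "0 < n" shows "1 \<le> stirling_ratio n"
proof -
  \<comment> \<open>The summand \<open>1 / (4 * n)\<close> absorbs the trapezoidal error: multiplied
    by \<open>n + 1/2\<close>, the upper bound is
    \<open>1 + 1 / (4 * n) - 1 / (4 * (n + 1))\<close>, which telescopes. At \<open>n = 1\<close>
    the ratio is e and equality holds.\<close>
  have "3/4 + 1 / (4 * real n) \<le> ln (stirling_ratio n)" using assms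
  proof (induction n rule: nat_induct_non_zero)
    case 1
    show ?case by (simp add: stirling_ratio_def)
  next
    case (Suc n)
    have "ln ((real n + 1) / real n) * (real n + 1/2)
        \<le> (2 * real n + 1) / (2 * real n * (real n + 1)) * (real n + 1/2)"
      using Suc by (intro mult_right_mono ln_one_plus_inverse_bounds) auto
    also have "\<dots> = 1 + 1 / (4 * real n) - 1 / (4 * real (Suc n))"
      using Suc by (simp add: divide_simps) (simp add: algebra_simps)
    finally show ?case using ln_stirling_ratio(2)[of n] Suc by (simp add: algebra_simps)
  qed
  then have "0 \<le> ln (stirling_ratio n)" by (rule order_trans[rotated]) simp
  then show ?thesis using ln_stirling_ratio(1)[OF assms] by simp
qed

definition binomial_mode :: "nat \<Rightarrow> nat \<Rightarrow> real" where
  "binomial_mode n j = real (n choose j) * (real j / real n) ^ j * (1 - real j / real n) ^ (n - j)"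

lemma binomial_mode_le_1:
  assumes "j \<le> n" shows "binomial_mode n j \<le> 1"
proof -
  let ?x = "real j / real n"
  have x: "0 \<le> ?x" "?x \<le> 1" using assms by (auto simp: divide_le_eq)
  have "binomial_mode n j \<le> (\<Sum>i\<le>n. real (n choose i) * ?x ^ i * (1 - ?x) ^ (n - i))"
    unfolding binomial_mode_def using assms x by (intro member_le_sum) auto
  also have "\<dots> = (?x + (1 - ?x)) ^ n" by (subst binomial_ring) simp
  finally show ?thesis by simp
qed

text \<open>All powers and exponentials cancel between the factorials and the probabilities. What
  remains is the square root times a quotient of Stirling ratios, at most 1 because the ratio at
  \<open>n\<close> is at most that at \<open>j\<close> and the ratio at \<open>n - j\<close> is at
  least 1.\<close>

lemma binomial_mode_le_sqrt:
  assumes "0 < j" "j < n"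
  shows "binomial_mode n j \<le> sqrt (real n / (real j * (real n - real j)))"
proof -
  define m where "m = n - j"
  have m: "0 < m" "n = j + m" using assms by (auto simp: m_def)
  have f: "fact i = stirling_ratio i * real i ^ i * sqrt (real i) / exp (real i)" if "0 < i" for i
    using that by (simp add: stirling_ratio_def)
  have "binomial_mode n j
      = fact n / (fact j * fact m) * ((real j / real n) ^ j * (real m / real n) ^ m)"
  proof -
    have "1 - real j / real n = real m / real n" using m by (simp add: field_simps)
    moreover have "real (n choose j) = fact n / (fact j * fact m)"
      using assms by (simp add: binomial_fact m_def)
    ultimately show ?thesis by (simp add: binomial_mode_def m_def)
  qed
  also have "(real j / real n) ^ j * (real m / real n) ^ m = real j ^ j * real m ^ m / real n ^ n"
    using m by (simp add: power_divide power_add)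
  also have "fact n / (fact j * fact m) * (real j ^ j * real m ^ m / real n ^ n)
     = (stirling_ratio n / stirling_ratio j / stirling_ratio m) * (sqrt (real n) / (sqrt (real j) * sqrt (real m)))"
    unfolding f[of n, OF order.strict_trans[OF assms]] f[OF assms(1)] f[OF m(1)]
    using assms m by (simp add: divide_simps exp_add power_add)
  also have "\<dots> \<le> 1 * (sqrt (real n) / (sqrt (real j) * sqrt (real m)))"
  proof (rule mult_right_mono)
    have "stirling_ratio n / stirling_ratio j \<le> 1"
      using stirling_ratio_decreasing[of j n] ln_stirling_ratio(1)[of j] assms by simp
    then have "stirling_ratio n / stirling_ratio j \<le> stirling_ratio m"
      using stirling_ratio_ge_1[OF m(1)] by linarith
    then show "stirling_ratio n / stirling_ratio j / stirling_ratio m \<le> 1"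
      using ln_stirling_ratio(1)[of m] m(1) by (subst divide_le_eq_1_pos) auto
  qed auto
  also have "\<dots> = sqrt (real n / (real j * (real n - real j)))"
    using m by (simp add: real_sqrt_divide real_sqrt_mult)
  finally show ?thesis .
qed

section \<open>Elementary sums of exponentials\<close>

lemma sum_exp_le:
  assumes "0 < \<kappa>" shows "(\<Sum>n\<in>{1..<T}. exp (- (real n * \<kappa>))) \<le> 1 / \<kappa>"
proof -
  \<comment> \<open>The right side is the integral of \<open>exp (- u * \<kappa>)\<close> over
    \<open>[0, m]\<close>, which dominates its right Riemann sum.\<close>
  have *: "(\<Sum>n\<in>{1..<Suc m}. exp (- (real n * \<kappa>))) \<le> (1 - exp (- (real m * \<kappa>))) / \<kappa>" for m
  proof (induction m)
    case (Suc m)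
    have "1 + \<kappa> \<le> exp \<kappa>" by simp
    then have "(1 + \<kappa>) * exp (- (real (Suc m) * \<kappa>)) \<le> exp \<kappa> * exp (- (real (Suc m) * \<kappa>))"
      by (intro mult_right_mono) auto
    also have "\<dots> = exp (- (real m * \<kappa>))" by (simp flip: exp_add add: algebra_simps)
    finally have "(1 - exp (- (real m * \<kappa>)) + \<kappa> * exp (- (real (Suc m) * \<kappa>))) / \<kappa>
        \<le> (1 - exp (- (real (Suc m) * \<kappa>))) / \<kappa>"
      using assms by (intro divide_right_mono) (auto simp: algebra_simps)
    then have "(1 - exp (- (real m * \<kappa>))) / \<kappa> + exp (- (real (Suc m) * \<kappa>))
        \<le> (1 - exp (- (real (Suc m) * \<kappa>))) / \<kappa>"
      using assms by (simp add: add_divide_distrib)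
    then show ?case using Suc by simp
  qed simp
  have "(\<Sum>n\<in>{1..<T}. exp (- (real n * \<kappa>))) \<le> (1 - exp (- (real (T - 1) * \<kappa>))) / \<kappa>"
    using *[of "T - 1"] assms by (cases T) auto
  also have "\<dots> \<le> 1 / \<kappa>" using assms by (intro divide_right_mono) auto
  finally show ?thesis .
qed

lemma sum_inverse_sqrt_le: "(\<Sum>n\<in>{1..m}. 1 / sqrt (real n)) \<le> 2 * sqrt (real m)"
proof (induction m)
  case (Suc m)
  have *: "1 / a \<le> 2 * a - 2 * b" if "0 < a" "a\<^sup>2 = b\<^sup>2 + 1" for a b :: real
  proof -
    have "0 \<le> (a - b)\<^sup>2" by simp
    then have "1 \<le> (2 * a - 2 * b) * a" using that(2) by (simp add: power2_eq_square algebra_simps)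
    then show ?thesis using that(1) by (simp add: divide_le_eq)
  qed
  have "1 / sqrt (real (Suc m)) \<le> 2 * sqrt (real (Suc m)) - 2 * sqrt (real m)"
    by (rule *) auto
  then show ?case using Suc by simp
qed simp

lemma sum_exp_div_sqrt_le:
  assumes "0 < k" shows "(\<Sum>n\<in>{1..<T}. exp (- (real n * k)) / sqrt (real n)) \<le> 3 / sqrt k"
proof -
  \<comment> \<open>The sum is cut at \<open>1 / k\<close>. Below, the exponential is dropped and
    the terms sum to at most \<open>2 / sqrt k\<close>; above, \<open>1 / sqrt n <= sqrt k\<close>
    and \<open>sum_exp_le\<close> gives \<open>1 / sqrt k\<close>.\<close>
  define m where "m = nat \<lfloor>1 / k\<rfloor>"
  have mk: "real m \<le> 1 / k" using assms by (simp add: m_def)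
  have nm: "1 / k < real n" if "m < n" for n
    using that assms unfolding m_def by linarith
  have "(\<Sum>n\<in>{1..<T}. exp (- (real n * k)) / sqrt (real n))
     \<le> (\<Sum>n\<in>{1..<T}. (if n \<le> m then 1 / sqrt (real n) else 0) + sqrt k * exp (- (real n * k)))"
  proof (rule sum_mono)
    fix n assume n: "n \<in> {1..<T}"
    show "exp (- (real n * k)) / sqrt (real n)
       \<le> (if n \<le> m then 1 / sqrt (real n) else 0) + sqrt k * exp (- (real n * k))"
    proof (cases "n \<le> m")
      case True
      have "exp (- (real n * k)) / sqrt (real n) \<le> 1 / sqrt (real n)"
        using assms by (intro divide_right_mono) auto
      moreover have "0 \<le> sqrt k * exp (- (real n * k))" using assms by simp
      ultimately show ?thesis using True by simp
    next
      case False
      then have "1 / k < real n" using nm by simp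
      then have "1 / real n \<le> k" using assms n by (simp add: field_simps)
      then have "sqrt (1 / real n) \<le> sqrt k" by simp
      then have "1 / sqrt (real n) * exp (- (real n * k)) \<le> sqrt k * exp (- (real n * k))"
        by (intro mult_right_mono) (auto simp: real_sqrt_divide)
      then show ?thesis using False by simp
    qed
  qed
  also have "\<dots> = (\<Sum>n\<in>{1..<T}. if n \<le> m then 1 / sqrt (real n) else 0)
      + sqrt k * (\<Sum>n\<in>{1..<T}. exp (- (real n * k)))"
    by (simp add: sum.distrib sum_distrib_left)
  also have "(\<Sum>n\<in>{1..<T}. if n \<le> m then 1 / sqrt (real n) else 0)
      = (\<Sum>n\<in>{1..<T} \<inter> {n. n \<le> m}. 1 / sqrt (real n))"
    by (simp add: sum.inter_restrict)
  also have "\<dots> \<le> (\<Sum>n\<in>{1..m}. 1 / sqrt (real n))"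
    by (intro sum_mono2) auto
  also have "\<dots> \<le> 2 * sqrt (real m)" by (rule sum_inverse_sqrt_le)
  also have "\<dots> \<le> 2 * sqrt (1 / k)" using mk by simp
  also have "sqrt k * (\<Sum>n\<in>{1..<T}. exp (- (real n * k))) \<le> sqrt k * (1 / k)"
    using assms by (intro mult_left_mono sum_exp_le) auto
  also have "2 * sqrt (1 / k) + sqrt k * (1 / k) = 3 / sqrt k"
    using assms by (simp add: real_sqrt_divide field_simps)
  finally show ?thesis by simp
qed

lemma sum_geometric_below_le:
  assumes "0 < s" "0 \<le> X"
  shows "(\<Sum>j | real j \<le> X. exp (- (s * (X - real j)))) \<le> 1 + 1 / s"
proof -
  define m where "m = nat \<lfloor>X\<rfloor>"
  have mX: "real m \<le> X" using assms by (simp add: m_def)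
  have set: "{j. real j \<le> X} = {..m}"
    using assms unfolding m_def by (auto simp: le_nat_floor) linarith
  have r: "exp (- s) < 1" using assms by simp
  have "(\<Sum>j | real j \<le> X. exp (- (s * (X - real j)))) \<le> (\<Sum>j\<le>m. exp (- s) ^ (m - j))"
    unfolding set
  proof (rule sum_mono)
    fix j assume "j \<in> {..m}"
    then have "exp (- s) ^ (m - j) = exp (- (s * (real m - real j)))"
      by (simp flip: exp_of_nat_mult add: algebra_simps of_nat_diff)
    then show "exp (- (s * (X - real j))) \<le> exp (- s) ^ (m - j)"
      using mX assms by simp
  qed
  also have "\<dots> = (\<Sum>i\<le>m. exp (- s) ^ i)"
    by (rule sum.reindex_bij_witness[of _ "\<lambda>i. m - i" "\<lambda>i. m - i"]) auto
  also have "\<dots> = (1 - exp (- s) ^ Suc m) / (1 - exp (- s))"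
    using r sum_gp_basic[of "exp (- s)" m] by (simp add: field_simps)
  also have "\<dots> \<le> 1 / (1 - exp (- s))" using r by (intro divide_right_mono) auto
  also have "\<dots> \<le> 1 + 1 / s"
  proof -
    have "1 + s \<le> exp s" by simp
    then have "(1 + s) * exp (- s) \<le> exp s * exp (- s)" by (intro mult_right_mono) auto
    then have "(1 + s) * exp (- s) \<le> 1" by (simp flip: exp_add)
    then show ?thesis using assms r by (simp add: field_simps)
  qed
  finally show ?thesis .
qed

section \<open>Sums of independent rewards\<close>

text \<open>The expectation of \<open>\<phi>\<close> at \<open>S\<close> plus a sum of
  \<open>n\<close> independent rewards. As an iterated integral it splits off one reward exactly as
  a pull does, which suits the induction over rounds in \<open>arm_pulls_le_walk\<close>.\<close>

primrec walk :: "real measure \<Rightarrow> nat \<Rightarrow> (real \<Rightarrow> ennreal) \<Rightarrow> real \<Rightarrow> ennreal" where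
  "walk \<nu> 0 \<phi> S = \<phi> S"
| "walk \<nu> (Suc n) \<phi> S = (\<integral>\<^sup>+y. walk \<nu> n \<phi> (S + y) \<partial>\<nu>)"

lemma walk_mono: "(\<And>x. \<phi> x \<le> \<psi> x) \<Longrightarrow> walk \<nu> n \<phi> S \<le> walk \<nu> n \<psi> S"
  by (induction n arbitrary: S) (auto intro!: nn_integral_mono)

text \<open>The counterpart of \<open>walk\<close> for Bernoulli rewards of mean
  \<open>\<mu>\<close>, in closed form.\<close>

definition bin_mean :: "real \<Rightarrow> nat \<Rightarrow> (real \<Rightarrow> real) \<Rightarrow> real \<Rightarrow> real" where
  "bin_mean \<mu> n \<phi> S = (\<Sum>j\<le>n. real (n choose j) * \<mu> ^ j * (1 - \<mu>) ^ (n - j) * \<phi> (S + real j))"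

text \<open>Pascal's rule, read as conditioning on one coin; it matches the recursion of
  \<open>walk\<close>.\<close>

lemma bin_mean_Suc:
  "bin_mean \<mu> (Suc n) \<phi> S = (1 - \<mu>) * bin_mean \<mu> n \<phi> S + \<mu> * bin_mean \<mu> n \<phi> (S + 1)"
proof -
  let ?f = "\<lambda>j. \<mu> ^ j * (1 - \<mu>) ^ (Suc n - j) * \<phi> (S + real j)"
  have "bin_mean \<mu> (Suc n) \<phi> S = ?f 0 + (\<Sum>j\<le>n. real (Suc n choose Suc j) * ?f (Suc j))"
    unfolding bin_mean_def by (subst sum.atMost_Suc_shift) (simp add: mult.assoc)
  also have "\<dots> = (?f 0 + (\<Sum>j\<le>n. real (n choose Suc j) * ?f (Suc j))) + (\<Sum>j\<le>n. real (n choose j) * ?f (Suc j))"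
    by (simp add: sum.distrib algebra_simps)
  also have "?f 0 + (\<Sum>j\<le>n. real (n choose Suc j) * ?f (Suc j)) = (\<Sum>j\<le>Suc n. real (n choose j) * ?f j)"
    by (subst sum.atMost_Suc_shift) simp
  also have "\<dots> = (\<Sum>j\<le>n. real (n choose j) * ?f j)" by simp
  also have "\<dots> = (1 - \<mu>) * bin_mean \<mu> n \<phi> S"
    unfolding bin_mean_def sum_distrib_left by (intro sum.cong) (auto simp: Suc_diff_le)
  also have "(\<Sum>j\<le>n. real (n choose j) * ?f (Suc j)) = \<mu> * bin_mean \<mu> n \<phi> (S + 1)"
    unfolding bin_mean_def sum_distrib_left by (intro sum.cong) (auto simp: algebra_simps)
  finally show ?thesis .
qed

lemma exp_le_quadratic:
  fixes x :: real assumes "\<bar>x\<bar> \<le> 1" shows "exp x \<le> 1 + x + x\<^sup>2"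
proof (cases "0 \<le> x")
  case True then show ?thesis using assms exp_bound[of x] by auto
next
  case False
  \<comment> \<open>After multiplication by \<open>exp y\<close> the claim reads
    \<open>1 <= (1 - y + y^2) * exp y\<close>, and the second Taylor polynomial of
    \<open>exp y\<close> already suffices for it.\<close>
  define y where "y = - x"
  have y: "0 < y" "y \<le> 1" using False assms by (auto simp: y_def)
  have "1 + y + y\<^sup>2 / 2 \<le> exp y" using y by (intro exp_lower_Taylor_quadratic) auto
  moreover have "(1 - y + y\<^sup>2) * (1 + y + y\<^sup>2 / 2) = 1 + (y\<^sup>2 + y^3 + y^4) / 2"
    by (simp add: field_simps power2_eq_square power3_eq_cube power4_eq_xxxx)
  moreover have "0 \<le> 1 - y + y\<^sup>2" using y by simp
  ultimately have "1 + (y\<^sup>2 + y^3 + y^4) / 2 \<le> (1 - y + y\<^sup>2) * exp y"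
    using mult_left_mono[of "1 + y + y\<^sup>2 / 2" "exp y" "1 - y + y\<^sup>2"] by simp
  moreover have "0 \<le> (y\<^sup>2 + y^3 + y^4) / 2" using y by simp
  ultimately have "1 \<le> (1 - y + y\<^sup>2) * exp y" by linarith
  then have "1 * exp (- y) \<le> (1 - y + y\<^sup>2) * exp y * exp (- y)" by (intro mult_right_mono) auto
  then have "1 * exp (- y) \<le> (1 - y + y\<^sup>2) * (exp y * exp (- y))" by (simp only: mult.assoc)
  then show ?thesis by (simp flip: exp_add add: y_def)
qed

locale unit_prob = prob_space \<nu> for \<nu> :: "real measure" +
  assumes sets_borel [measurable_cong, simp]: "sets \<nu> = sets borel"
    and AE_unit: "AE y in \<nu>. y \<in> {0..1}"
begin

abbreviation "\<mu> \<equiv> \<integral>y. y \<partial>\<nu>"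

lemma integrable_unit [simp]: "integrable \<nu> (\<lambda>y. y)"
  by (rule integrable_const_bound[of _ 1]) (use AE_unit in auto)

lemma mean_unit: "\<mu> \<in> {0..1}"
proof -
  have "0 \<le> \<mu>" using AE_unit by (intro integral_nonneg_AE) auto
  moreover have "\<mu> \<le> (\<integral>y. 1 \<partial>\<nu>)" using AE_unit by (intro integral_mono_AE) auto
  ultimately show ?thesis by (simp add: prob_space)
qed

lemma nn_integral_id: "(\<integral>\<^sup>+y. ennreal y \<partial>\<nu>) = ennreal \<mu>"
  using AE_unit by (intro nn_integral_eq_integral) auto

lemma nn_integral_affine:
  assumes "0 \<le> a" "0 \<le> b"
  shows "(\<integral>\<^sup>+y. ennreal ((1 - y) * a + y * b) \<partial>\<nu>) = ennreal ((1 - \<mu>) * a + \<mu> * b)"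
proof -
  have "(\<integral>\<^sup>+y. ennreal ((1 - y) * a + y * b) \<partial>\<nu>) = ennreal (\<integral>y. (1 - y) * a + y * b \<partial>\<nu>)"
    using AE_unit assms by (intro nn_integral_eq_integral) auto
  also have "(\<integral>y. (1 - y) * a + y * b \<partial>\<nu>) = (1 - \<mu>) * a + \<mu> * b"
    by (simp add: prob_space)
  finally show ?thesis .
qed

lemma walk_measurable [measurable]:
  assumes [measurable]: "\<phi> \<in> borel_measurable borel"
  shows "walk \<nu> n \<phi> \<in> borel_measurable borel"
proof (induction n)
  case (Suc n)
  note [measurable] = Suc
  have "(\<lambda>S. \<integral>\<^sup>+y. walk \<nu> n \<phi> (S + y) \<partial>\<nu>) \<in> borel_measurable borel" by measurable
  then show ?case by (subst walk.simps(2)[abs_def]) 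
qed (simp add: assms)

lemma walk_add:
  assumes [measurable]: "\<phi> \<in> borel_measurable borel" "\<psi> \<in> borel_measurable borel"
  shows "walk \<nu> n (\<lambda>x. \<phi> x + \<psi> x) S = walk \<nu> n \<phi> S + walk \<nu> n \<psi> S"
proof (induction n arbitrary: S)
  case (Suc n)
  show ?case by (simp add: Suc nn_integral_add)
qed simp

lemma walk_exp_le:
  assumes M: "(\<integral>\<^sup>+y. ennreal (exp (l * y)) \<partial>\<nu>) \<le> ennreal M" and "0 \<le> M"
  shows "walk \<nu> n (\<lambda>x. ennreal (exp (l * x - b))) S \<le> ennreal (exp (l * S - b) * M ^ n)"
proof (induction n arbitrary: S)
  case (Suc n)
  have "walk \<nu> (Suc n) (\<lambda>x. ennreal (exp (l * x - b))) S
      \<le> (\<integral>\<^sup>+y. ennreal (exp (l * (S + y) - b) * M ^ n) \<partial>\<nu>)"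
    by (simp add: Suc nn_integral_mono)
  also have "\<dots> = (\<integral>\<^sup>+y. ennreal (exp (l * S - b) * M ^ n) * ennreal (exp (l * y)) \<partial>\<nu>)"
    using \<open>0 \<le> M\<close> by (intro nn_integral_cong)
      (simp flip: ennreal_mult exp_add add: algebra_simps)
  also have "\<dots> = ennreal (exp (l * S - b) * M ^ n) * (\<integral>\<^sup>+y. ennreal (exp (l * y)) \<partial>\<nu>)"
    by (rule nn_integral_cmult) measurable
  also have "\<dots> \<le> ennreal (exp (l * S - b) * M ^ n) * ennreal M"
    by (intro mult_left_mono M) auto
  finally show ?case using \<open>0 \<le> M\<close> by (simp flip: ennreal_mult add: ac_simps)
qed simp

text \<open>\<open>exp_le_quadratic\<close> is applied to \<open>l * (y - \<mu>)\<close>. Since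
  \<open>y * y <= y\<close> on the unit interval, the quadratic term is bounded by an affine
  function of \<open>y\<close>, whose mean is the Bernoulli variance
  \<open>\<mu> * (1 - \<mu>)\<close>.\<close>

lemma mgf_le:
  assumes l: "\<bar>l\<bar> \<le> 1" and V: "\<mu> * (1 - \<mu>) \<le> V"
  shows "(\<integral>\<^sup>+y. ennreal (exp (l * y)) \<partial>\<nu>) \<le> ennreal (exp (l * \<mu> + l\<^sup>2 * V))"
proof -
  let ?h = "\<lambda>y. (1 + l * (y - \<mu>)) + l\<^sup>2 * ((1 - 2 * \<mu>) * y + \<mu>\<^sup>2)"
  have "AE y in \<nu>. exp (l * y) \<le> exp (l * \<mu>) * ?h y"
  proof (rule AE_mp[OF AE_unit], rule AE_I2, intro impI)
    fix y assume y: "y \<in> {0..1::real}"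
    have "\<bar>l * (y - \<mu>)\<bar> \<le> 1 * 1" using l y mean_unit unfolding abs_mult by (intro mult_mono) auto
    then have "exp (l * (y - \<mu>)) \<le> 1 + l * (y - \<mu>) + (l * (y - \<mu>))\<^sup>2"
      by (intro exp_le_quadratic) auto
    also have "(l * (y - \<mu>))\<^sup>2 = l\<^sup>2 * (y * y - 2 * \<mu> * y + \<mu>\<^sup>2)"
      by (simp add: power_mult_distrib power2_eq_square algebra_simps)
    also have "\<dots> \<le> l\<^sup>2 * (y - 2 * \<mu> * y + \<mu>\<^sup>2)"
      using y mult_left_le[of y y] by (intro mult_left_mono) auto
    finally have "exp (l * (y - \<mu>)) \<le> ?h y" by (simp add: algebra_simps)
    then have "exp (l * \<mu>) * exp (l * (y - \<mu>)) \<le> exp (l * \<mu>) * ?h y" by (intro mult_left_mono) auto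
    then show "exp (l * y) \<le> exp (l * \<mu>) * ?h y" by (simp flip: exp_add add: algebra_simps)
  qed
  note h = this
  have "(\<integral>\<^sup>+y. ennreal (exp (l * y)) \<partial>\<nu>) \<le> (\<integral>\<^sup>+y. ennreal (exp (l * \<mu>) * ?h y) \<partial>\<nu>)"
    using h by (intro nn_integral_mono_AE) (auto intro: ennreal_leI)
  also have "\<dots> = ennreal (\<integral>y. exp (l * \<mu>) * ?h y \<partial>\<nu>)"
  proof (rule nn_integral_eq_integral)
    show "AE y in \<nu>. 0 \<le> exp (l * \<mu>) * ?h y"
      using h by (rule AE_mp) (auto intro!: AE_I2 intro: order_trans[OF exp_ge_zero])
  qed simp
  also have "(\<integral>y. exp (l * \<mu>) * ?h y \<partial>\<nu>) = exp (l * \<mu>) * (1 + l\<^sup>2 * (\<mu> * (1 - \<mu>)))"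
    by (simp add: prob_space power2_eq_square algebra_simps)
  also have "\<dots> \<le> exp (l * \<mu>) * exp (l\<^sup>2 * V)"
  proof (rule mult_left_mono)
    have "1 + l\<^sup>2 * (\<mu> * (1 - \<mu>)) \<le> 1 + l\<^sup>2 * V" using V by (auto intro: mult_left_mono)
    also have "\<dots> \<le> exp (l\<^sup>2 * V)" by simp
    finally show "1 + l\<^sup>2 * (\<mu> * (1 - \<mu>)) \<le> exp (l\<^sup>2 * V)" .
  qed simp
  finally show ?thesis by (simp add: exp_add ennreal_leI)
qed

text \<open>Chernoff bounds, summed over all sample sizes; the sign \<open>\<sigma>\<close> selects
  the upper or the lower tail.\<close>

lemma tail_sum_le:
  assumes sgn: "\<sigma> = 1 \<or> \<sigma> = - 1" and "0 < \<epsilon>" "\<epsilon> \<le> V" "\<mu> * (1 - \<mu>) \<le> V"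
  shows "(\<Sum>n\<in>{1..<T}. walk \<nu> n (indicator {S. real n * \<epsilon> \<le> \<sigma> * (S - real n * \<mu>)}) 0) \<le> ennreal (4 * V / \<epsilon>\<^sup>2)"
proof -
  \<comment> \<open>This \<open>l\<close> maximizes \<open>l * \<epsilon> - l^2 * V\<close>, with
    maximum \<open>\<kappa>\<close>. The assumption \<open>\<epsilon> <= V\<close> keeps it in the
    range of \<open>mgf_le\<close>.\<close>
  define l where "l = \<epsilon> / (2 * V)"
  define \<kappa> where "\<kappa> = \<epsilon>\<^sup>2 / (4 * V)"
  have V: "0 < V" using assms by simp
  have l: "0 < l" "l \<le> 1" using assms V by (auto simp: l_def)
  have sl: "\<bar>\<sigma> * l\<bar> \<le> 1" "(\<sigma> * l)\<^sup>2 = l\<^sup>2" using sgn l by auto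
  have lk: "l * \<epsilon> - l\<^sup>2 * V = \<kappa>"
    using V by (simp add: l_def \<kappa>_def power2_eq_square field_simps)
  have "walk \<nu> n (indicator {S. real n * \<epsilon> \<le> \<sigma> * (S - real n * \<mu>)}) 0 \<le> ennreal (exp (- (real n * \<kappa>)))" for n
  proof -
    let ?b = "real n * (l * \<epsilon> + \<sigma> * l * \<mu>)"
    have "walk \<nu> n (indicator {S. real n * \<epsilon> \<le> \<sigma> * (S - real n * \<mu>)}) 0
        \<le> walk \<nu> n (\<lambda>S. ennreal (exp (\<sigma> * l * S - ?b))) 0"
    proof (rule walk_mono)
      fix S :: real
      show "indicator {S. real n * \<epsilon> \<le> \<sigma> * (S - real n * \<mu>)} S \<le> ennreal (exp (\<sigma> * l * S - ?b))"
      proof (cases "real n * \<epsilon> \<le> \<sigma> * (S - real n * \<mu>)")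
        case True
        then have "l * (real n * \<epsilon>) \<le> l * (\<sigma> * (S - real n * \<mu>))" using l by (intro mult_left_mono) auto
        then have "0 \<le> \<sigma> * l * S - ?b" by (simp add: algebra_simps)
        then show ?thesis using True by simp
      qed simp
    qed
    also have "\<dots> \<le> ennreal (exp (\<sigma> * l * 0 - ?b) * exp (\<sigma> * l * \<mu> + l\<^sup>2 * V) ^ n)"
      using mgf_le[OF sl(1) assms(4)] sl(2) by (intro walk_exp_le) auto
    also have "exp (\<sigma> * l * 0 - ?b) * exp (\<sigma> * l * \<mu> + l\<^sup>2 * V) ^ n = exp (- (real n * \<kappa>))"
      unfolding lk[symmetric] by (simp flip: exp_of_nat_mult exp_add add: algebra_simps)
    finally show ?thesis .
  qed
  then have "(\<Sum>n\<in>{1..<T}. walk \<nu> n (indicator {S. real n * \<epsilon> \<le> \<sigma> * (S - real n * \<mu>)}) 0)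
      \<le> (\<Sum>n\<in>{1..<T}. ennreal (exp (- (real n * \<kappa>))))" by (rule sum_mono)
  also have "\<dots> = ennreal (\<Sum>n\<in>{1..<T}. exp (- (real n * \<kappa>)))" by (rule sum_ennreal) simp
  also have "\<dots> \<le> ennreal (1 / \<kappa>)"
    using V assms by (intro ennreal_leI sum_exp_le) (auto simp: \<kappa>_def)
  finally show ?thesis by (simp add: \<kappa>_def)
qed

text \<open>A convex function lies below its chord over a unit interval, and the chord at
  \<open>y\<close> is the mean over a coin of bias \<open>y\<close>. So each reward may be replaced
  by a coin of the same mean, one at a time; \<open>S + n <= N\<close> keeps all points in the
  domain of convexity.\<close>

lemma walk_le_bin_mean:
  assumes [measurable]: "\<phi> \<in> borel_measurable borel" and nonneg: "\<And>x. 0 \<le> \<phi> x"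
    and convex: "convex_on {0..N} \<phi>"
  shows "0 \<le> S \<Longrightarrow> S + real n \<le> N \<Longrightarrow> walk \<nu> n (\<lambda>x. ennreal (\<phi> x)) S \<le> ennreal (bin_mean \<mu> n \<phi> S)"
proof (induction n arbitrary: S)
  case 0 then show ?case by (simp add: bin_mean_def)
next
  case (Suc n)
  have b0: "0 \<le> bin_mean \<mu> n \<phi> x" for x
    unfolding bin_mean_def using mean_unit nonneg by (intro sum_nonneg) auto
  have chord: "bin_mean \<mu> n \<phi> (S + y) \<le> (1 - y) * bin_mean \<mu> n \<phi> S + y * bin_mean \<mu> n \<phi> (S + 1)"
    if y: "y \<in> {0..1}" for y
  proof -
    have "\<phi> (S + y + real j) \<le> (1 - y) * \<phi> (S + real j) + y * \<phi> (S + 1 + real j)" if "j \<le> n" for j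
      using convex_onD[OF convex, of y "S + real j" "S + 1 + real j"] that y Suc.prems
      by (simp add: algebra_simps)
    then have "bin_mean \<mu> n \<phi> (S + y) \<le> (\<Sum>j\<le>n. real (n choose j) * \<mu> ^ j * (1 - \<mu>) ^ (n - j) *
        ((1 - y) * \<phi> (S + real j) + y * \<phi> (S + 1 + real j)))"
      unfolding bin_mean_def using mean_unit by (intro sum_mono mult_left_mono) auto
    also have "\<dots> = (1 - y) * bin_mean \<mu> n \<phi> S + y * bin_mean \<mu> n \<phi> (S + 1)"
      unfolding bin_mean_def sum_distrib_left sum.distrib[symmetric]
      by (intro sum.cong) (auto simp: algebra_simps)
    finally show ?thesis .
  qed
  have "walk \<nu> (Suc n) (\<lambda>x. ennreal (\<phi> x)) S \<le> (\<integral>\<^sup>+y. ennreal (bin_mean \<mu> n \<phi> (S + y)) \<partial>\<nu>)"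
    unfolding walk.simps using AE_unit
    by (intro nn_integral_mono_AE, elim AE_mp) (use Suc in \<open>auto intro!: AE_I2 Suc.IH\<close>)
  also have "\<dots> \<le> (\<integral>\<^sup>+y. ennreal ((1 - y) * bin_mean \<mu> n \<phi> S + y * bin_mean \<mu> n \<phi> (S + 1)) \<partial>\<nu>)"
    using AE_unit by (intro nn_integral_mono_AE, elim AE_mp) (auto intro!: AE_I2 ennreal_leI chord)
  also have "\<dots> = ennreal (bin_mean \<mu> (Suc n) \<phi> S)"
    unfolding bin_mean_Suc by (intro nn_integral_affine b0)
  finally show ?case .
qed

end

section \<open>The exponentially weighted lower tail\<close>

lemma exp_kl_convex:
  assumes q: "q \<in> {0<..<1}"
  shows "convex_on {0..1} (\<lambda>x. exp (real n * kl (min x q) q))"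
proof (rule convex_onI)
  fix t x y :: real
  assume t: "0 < t" "t < 1" and x: "x \<in> {0..1}" and y: "y \<in> {0..1}"
  define h where "h x = kl (min x q) q" for x
  define z where "z = (1 - t) * x + t * y"
  define a where "a = min z q"
  define L where "L x = x * ln (a / q) + (1 - x) * ln ((1 - a) / (1 - q))" for x
  have z: "0 \<le> z" using t x y by (simp add: z_def)
  \<comment> \<open>\<open>h\<close> is a supremum of affine functions: \<open>L\<close> lies below \<open>h\<close> and touches it at \<open>z\<close>.\<close>
  have "h z \<le> (1 - t) * h x + t * h y"
  proof (cases "z = 0")
    \<comment> \<open>At \<open>z = 0\<close> the supporting line would involve \<open>ln 0\<close>;
      but a proper convex combination vanishes only if both points do.\<close>
    case True
    then have "x = 0 \<and> y = 0" using t x y add_nonneg_eq_0_iff[of "(1 - t) * x" "t * y"]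
      by (auto simp: z_def)
    then show ?thesis using True by (simp add: algebra_simps)
  next
    case False
    have a: "a \<in> {0<..<1}" "a \<le> q" using q z False by (auto simp: a_def)
    have Lh: "L w \<le> h w" if w: "w \<in> {0..1}" for w
    proof (cases "w \<le> q")
      case True
      then show ?thesis using kl_diff[OF w a(1) q] kl_nonneg[OF w a(1)] by (simp add: h_def L_def)
    next
      case False
      have "(w - q) * ln (a / q) \<le> 0" using False a by (intro mult_nonneg_nonpos) auto
      moreover have "0 \<le> (w - q) * ln ((1 - a) / (1 - q))" using False a q by (intro mult_nonneg_nonneg) auto
      moreover have "L q \<le> 0" using kl_diff[of q a q] kl_nonneg[of q a] a q by (simp add: L_def)
      ultimately have "L w \<le> 0" by (simp add: L_def algebra_simps)
      then show ?thesis using False by (simp add: h_def)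
    qed
    have "h z = L z"
    proof (cases "z \<le> q")
      case True
      then have az: "a = z" by (simp add: a_def)
      show ?thesis using kl_diff[of z a q] a q True unfolding az by (simp add: h_def L_def az)
    next
      case False
      then show ?thesis using q by (simp add: h_def L_def a_def)
    qed
    also have "L z = (1 - t) * L x + t * L y" by (simp add: z_def L_def algebra_simps)
    also have "\<dots> \<le> (1 - t) * h x + t * h y"
      using t Lh[OF x] Lh[OF y] by (intro add_mono mult_left_mono) auto
    finally show ?thesis .
  qed
  then have "real n * h z \<le> real n * ((1 - t) * h x + t * h y)" by (intro mult_left_mono) auto
  then have "exp (real n * h z) \<le> exp ((1 - t) * (real n * h x) + t * (real n * h y))"
    by (simp add: algebra_simps)
  also have "\<dots> \<le> (1 - t) * exp (real n * h x) + t * exp (real n * h y)"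
    using convex_onD[OF exp_convex, of t "real n * h x" "real n * h y"] t by simp
  finally show "exp (real n * kl (min ((1 - t) *\<^sub>R x + t *\<^sub>R y) q) q)
      \<le> (1 - t) * exp (real n * kl (min x q) q) + t * exp (real n * kl (min y q) q)"
    by (simp add: h_def z_def)
qed simp

text \<open>\<open>n * kl (j / n) \<mu>\<close> is the log-likelihood ratio between the biases
  \<open>j / n\<close> and \<open>\<mu>\<close> at the outcome \<open>j\<close>, so the factor
  replaces one bias by the other exactly. At \<open>j = 0\<close> and \<open>j = n\<close> this
  relies on the convention \<open>0 ln 0 = 0\<close>.\<close>

lemma binomial_prob_exp_kl:
  assumes "j \<le> n" "0 < n" "\<mu> \<in> {0<..<1}"
  shows "real (n choose j) * \<mu> ^ j * (1 - \<mu>) ^ (n - j) * exp (real n * kl (real j / real n) \<mu>) = binomial_mode n j"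
proof -
  let ?x = "real j / real n"
  have "exp (real n * (if ?x = 0 then 0 else ?x * ln (?x / \<mu>))) = (?x / \<mu>) ^ j"
  proof (cases "j = 0")
    case False
    then have "real n * (?x * ln (?x / \<mu>)) = real j * ln (?x / \<mu>)" using assms by simp
    then show ?thesis using False assms by (simp add: exp_of_nat_mult)
  qed simp
  moreover have "exp (real n * (if ?x = 1 then 0 else (1 - ?x) * ln ((1 - ?x) / (1 - \<mu>))))
      = ((1 - ?x) / (1 - \<mu>)) ^ (n - j)"
  proof (cases "j = n")
    case False
    then have x: "?x < 1" using assms by simp
    have "real n * (1 - ?x) = real (n - j)" using assms by (simp add: field_simps of_nat_diff)
    then have A: "real n * ((1 - ?x) * ln ((1 - ?x) / (1 - \<mu>))) = real (n - j) * ln ((1 - ?x) / (1 - \<mu>))"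
      by (simp only: mult.assoc[symmetric])
    have B: "exp (real (n - j) * ln ((1 - ?x) / (1 - \<mu>))) = ((1 - ?x) / (1 - \<mu>)) ^ (n - j)"
      using x assms by (subst exp_of_nat_mult) auto
    have "?x \<noteq> 1" using x by (rule less_imp_neq)
    then show ?thesis by (simp only: A B if_False)
  qed (use assms in simp)
  ultimately have "exp (real n * kl ?x \<mu>) = (?x / \<mu>) ^ j * ((1 - ?x) / (1 - \<mu>)) ^ (n - j)"
    unfolding kl_def distrib_left exp_add by simp
  then show ?thesis using assms by (simp add: binomial_mode_def power_divide power_mult_distrib)
qed

lemma binomial_tilted_sum_le:
  assumes q: "0 < q" "q < \<mu>" "\<mu> < 1" "3 / 4 * \<mu> \<le> q"
  shows "(\<Sum>n\<in>{1..<T}. \<Sum>j | real j \<le> real n * q.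
            real (n choose j) * \<mu> ^ j * (1 - \<mu>) ^ (n - j) * exp (real n * kl (real j / real n) q))
         \<le> 14 * (\<mu> * (1 - q) / (\<mu> - q)\<^sup>2)"
proof -
  define k where "k = kl q \<mu>"
  define s where "s = ln (\<mu> / q) + ln ((1 - q) / (1 - \<mu>))"
  define V where "V = \<mu> * (1 - q)"
  define \<epsilon> where "\<epsilon> = \<mu> - q"
  define \<beta> where "\<beta> = sqrt (2 / (q * (1 - q)))"
  define pr where "pr n j = real (n choose j) * \<mu> ^ j * (1 - \<mu>) ^ (n - j)
    * exp (real n * kl (real j / real n) q)" for n j
  have pos: "0 < V" "0 < \<epsilon>" "0 < q * (1 - q)" using q by (auto simp: V_def \<epsilon>_def)
  have k_ge: "\<epsilon>\<^sup>2 / (2 * V) \<le> k" unfolding k_def \<epsilon>_def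
  proof (rule kl_ge_quadratic)
    fix t assume t: "q \<le> t" "t \<le> \<mu>"
    then show "t * (1 - t) \<le> V" unfolding V_def using q by (intro mult_mono) auto
  qed (use q pos in auto)
  then have k: "0 < k" by (rule less_le_trans[rotated]) (use pos in simp)
  have s_ge: "\<epsilon> / V \<le> s"
  proof -
    \<comment> \<open>The number \<open>1 - \<epsilon> / V\<close> is the odds ratio
      \<open>exp (- s)\<close>, so \<open>ln u <= u - 1\<close> at this point bounds
      \<open>s\<close> from below.\<close>
    have eq: "1 - \<epsilon> / V = q * (1 - \<mu>) / (\<mu> * (1 - q))"
      using q by (simp add: V_def \<epsilon>_def divide_simps) (simp add: algebra_simps)
    have "ln (q * (1 - \<mu>) / (\<mu> * (1 - q))) \<le> q * (1 - \<mu>) / (\<mu> * (1 - q)) - 1"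
      using q by (intro ln_le_minus_one) auto
    moreover have "ln (q * (1 - \<mu>) / (\<mu> * (1 - q))) = - s"
      using q by (simp add: s_def ln_div ln_mult)
    ultimately show ?thesis using eq by linarith
  qed
  then have s: "0 < s" by (rule less_le_trans[rotated]) (use pos in simp)
  have \<beta>: "0 < \<beta>" using pos by (simp add: \<beta>_def)
  \<comment> \<open>Passing from \<open>kl x \<mu>\<close> to \<open>kl x q\<close> adds an affine
    function of \<open>x\<close> with value \<open>- k\<close> at \<open>x = q\<close> and slope
    \<open>s\<close>, by two instances of \<open>kl_diff\<close>.\<close>
  have pr_eq: "pr n j = binomial_mode n j * exp (- (real n * k) - s * (real n * q - real j))"
    if "1 \<le> n" "j \<le> n" for n j
  proof -
    define x where "x = real j / real n"
    have x: "x \<in> {0..1}" using that by (simp add: x_def)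
    define A where "A = ln (\<mu> / q)"
    define B where "B = ln ((1 - \<mu>) / (1 - q))"
    have "kl x q - kl x \<mu> = x * A + (1 - x) * B" "- k = q * A + (1 - q) * B"
      using kl_diff[of x \<mu> q] kl_diff[of q \<mu> q] x q by (auto simp: k_def A_def B_def)
    moreover have sAB: "s = A - B" using q by (simp add: s_def A_def B_def ln_div)
    ultimately have "kl x q = kl x \<mu> - k - s * (q - x)"
      unfolding sAB by (simp add: algebra_simps)
    moreover have "real j = real n * x" using that by (simp add: x_def)
    ultimately have "real n * kl x q = real n * kl x \<mu> + (- (real n * k) - s * (real n * q - real j))"
      by (simp only:) (simp add: algebra_simps)
    then show ?thesis
      using binomial_prob_exp_kl[OF that(2), of \<mu>] q that
      by (simp add: pr_def x_def exp_add mult.assoc[symmetric])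
  qed
  \<comment> \<open>Close to \<open>j = 0\<close> the square root bound is useless. For
    \<open>j <= n q / 2\<close>, however, the distance to \<open>n q\<close> contributes an extra
    decay \<open>exp (- n s q / 2)\<close>, which is merged with \<open>k\<close> into the rate
    \<open>w\<close>.\<close>
  define w where "w = k + s * q / 2"
  have inner: "(\<Sum>j | real j \<le> real n * q. pr n j)
      \<le> (1 + 1 / s) * exp (- (real n * w)) + exp (- (real n * k)) + \<beta> / s * (exp (- (real n * k)) / sqrt (real n))"
    if n: "1 \<le> n" for n
  proof -
    define J where "J X = {j. real j \<le> X}" for X
    have finJ: "finite (J X)" for X
      by (rule finite_subset[of _ "{..nat \<lfloor>X\<rfloor>}"]) (auto simp: J_def le_nat_floor)
    \<comment> \<open>Both bounds on the mode are kept: the geometric sum over \<open>j\<close> is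
      at most \<open>1 + 1 / s\<close>, and \<open>b\<close> is estimated by 1 on the first summand
      and by \<open>\<beta> / sqrt n\<close> on the second.\<close>
    define b where "b = min 1 (\<beta> / sqrt (real n))"
    have b: "0 \<le> b" using \<beta> by (simp add: b_def)
    have nq: "0 < real n * q" using n q by simp
    have "(\<Sum>j\<in>J (real n * q). pr n j) \<le> (\<Sum>j\<in>J (real n * q).
        (if real j \<le> real n * q / 2 then exp (- (real n * w)) * exp (- (s * (real n * q / 2 - real j))) else 0)
        + b * exp (- (real n * k)) * exp (- (s * (real n * q - real j))))"
    proof (rule sum_mono)
      fix j assume "j \<in> J (real n * q)"
      then have jq: "real j \<le> real n * q" by (simp add: J_def)
      also have "\<dots> < real n * 1" using n q by (intro mult_strict_left_mono) auto
      finally have jn: "j < n" by simp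
      show "pr n j \<le> (if real j \<le> real n * q / 2 then exp (- (real n * w)) * exp (- (s * (real n * q / 2 - real j))) else 0)
        + b * exp (- (real n * k)) * exp (- (s * (real n * q - real j)))"
      proof (cases "real j \<le> real n * q / 2")
        case True
        have "pr n j \<le> 1 * exp (- (real n * k) - s * (real n * q - real j))"
          unfolding pr_eq[OF n less_imp_le[OF jn]]
          using jn by (intro mult_right_mono binomial_mode_le_1) auto
        also have "\<dots> = exp (- (real n * w)) * exp (- (s * (real n * q / 2 - real j)))"
          by (simp flip: exp_add add: w_def algebra_simps)
        finally show ?thesis using True b by (simp add: add_increasing2)
      next
        case False
        then have j: "0 < j" "real n * q / 2 \<le> real j" using nq by (auto intro: Nat.gr0I)
        have pos': "0 < (real n * q / 2) * (real n * (1 - q))" using n q by simp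
        moreover have le: "(real n * q / 2) * (real n * (1 - q)) \<le> real j * (real n - real j)"
        proof (rule mult_mono[OF j(2)])
          show "real n * (1 - q) \<le> real n - real j" using jq by (simp add: right_diff_distrib)
        qed (use q in auto)
        ultimately have "real n / (real j * (real n - real j)) \<le> real n / ((real n * q / 2) * (real n * (1 - q)))"
          by (intro divide_left_mono[OF le]) (simp, intro mult_pos_pos[OF less_le_trans[OF pos' le] pos'])
        also have "\<dots> = 2 / (q * (1 - q)) / real n" using n q by (simp add: field_simps)
        finally have "sqrt (real n / (real j * (real n - real j))) \<le> \<beta> / sqrt (real n)"
          by (simp flip: real_sqrt_divide add: \<beta>_def)
        then have "binomial_mode n j \<le> b"
          using binomial_mode_le_sqrt[OF j(1) jn] binomial_mode_le_1[of j n] jn by (simp add: b_def)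
        then have "pr n j \<le> b * exp (- (real n * k) - s * (real n * q - real j))"
          unfolding pr_eq[OF n less_imp_le[OF jn]]
          by (intro mult_right_mono) auto
        also have "\<dots> = b * exp (- (real n * k)) * exp (- (s * (real n * q - real j)))"
          by (simp flip: exp_add add: mult.assoc)
        finally show ?thesis using False by simp
      qed
    qed
    also have "\<dots> = (\<Sum>j\<in>J (real n * q) \<inter> {j. real j \<le> real n * q / 2}. exp (- (real n * w)) * exp (- (s * (real n * q / 2 - real j))))
        + b * exp (- (real n * k)) * (\<Sum>j\<in>J (real n * q). exp (- (s * (real n * q - real j))))"
      by (simp add: sum.distrib sum_distrib_left sum.inter_restrict finJ)
    also have "J (real n * q) \<inter> {j. real j \<le> real n * q / 2} = J (real n * q / 2)"
      using nq by (auto simp: J_def)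
    also have "(\<Sum>j\<in>J (real n * q / 2). exp (- (real n * w)) * exp (- (s * (real n * q / 2 - real j))))
        \<le> exp (- (real n * w)) * (1 + 1 / s)"
      unfolding sum_distrib_left[symmetric] J_def using nq s
      by (intro mult_left_mono sum_geometric_below_le) auto
    also have "b * exp (- (real n * k)) * (\<Sum>j\<in>J (real n * q). exp (- (s * (real n * q - real j))))
        \<le> b * exp (- (real n * k)) * (1 + 1 / s)"
      unfolding J_def using nq s b by (intro mult_left_mono sum_geometric_below_le) auto
    also have "\<dots> = b * exp (- (real n * k)) + b * (exp (- (real n * k)) / s)"
      by (simp add: algebra_simps)
    also have "\<dots> \<le> 1 * exp (- (real n * k)) + \<beta> / sqrt (real n) * (exp (- (real n * k)) / s)"
      using s by (intro add_mono mult_right_mono) (auto simp: b_def)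
    finally show ?thesis by (simp add: J_def mult.commute)
  qed
  have w: "0 < w" using k s q by (simp add: w_def add_pos_pos)
  define r where "r = V / \<epsilon>\<^sup>2"
  have r: "0 < r" using pos by (simp add: r_def)
  have inv_k: "1 / k \<le> 2 * r"
    using k_ge k pos by (simp add: r_def field_simps)
  have Vq: "V * 3 \<le> q * 4"
  proof -
    have "V \<le> \<mu> * 1" unfolding V_def using q by (intro mult_left_mono) auto
    then show ?thesis using q by simp
  qed
  have inv_s: "1 / s \<le> V / \<epsilon>" using s_ge s pos by (simp add: field_simps)
  \<comment> \<open>The total 14 is 5 from here, 2 from \<open>1 / k\<close> and 7 from
    \<open>t3\<close>. The rate \<open>w\<close> is bounded below by \<open>k\<close> for the
    summand 1 and by \<open>s * q / 2\<close> for \<open>1 / s\<close>.\<close>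
  have t1: "(1 + 1 / s) / w \<le> 2 * r + 3 * r"
  proof -
    have "(1 + 1 / s) / w = 1 / w + (1 / s) / w" by (simp add: add_divide_distrib)
    moreover have "1 / w \<le> 1 / k" using k w s q by (intro divide_left_mono) (auto simp: w_def)
    moreover have "(1 / s) / w \<le> (1 / s) / (s * q / 2)"
      using k w s q by (intro divide_left_mono) (auto simp: w_def)
    moreover have "(1 / s) / (s * q / 2) = (1 / s) * (1 / s) * (2 / q)" by simp
    moreover have "(1 / s) * (1 / s) * (2 / q) \<le> (V / \<epsilon>) * (V / \<epsilon>) * (2 / q)"
      using inv_s s q pos by (intro mult_right_mono mult_mono) auto
    moreover have "(V / \<epsilon>) * (V / \<epsilon>) * (2 / q) = r * (2 * V / q)"
      by (simp add: r_def power2_eq_square ac_simps)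
    moreover have "r * (2 * V / q) \<le> r * 3"
      using Vq r q by (intro mult_left_mono) (auto simp: divide_le_eq)
    ultimately show ?thesis using inv_k by linarith
  qed
  \<comment> \<open>After squaring, the constant is \<open>18 * 2 * (4 / 3) = 48\<close>, below
    49.\<close>
  have t3: "\<beta> / s * (3 / sqrt k) \<le> 7 * r"
  proof (rule power2_le_imp_le)
    have "(\<beta> / s * (3 / sqrt k))\<^sup>2 = 18 / (q * (1 - q)) * ((1 / s) * (1 / s)) * (1 / k)"
      using pos k by (simp add: \<beta>_def power_mult_distrib power_divide power2_eq_square)
    also have "\<dots> \<le> 18 / (q * (1 - q)) * ((V / \<epsilon>) * (V / \<epsilon>)) * (2 * r)"
      using inv_s inv_k s k q pos by (intro mult_mono) auto
    also have "\<dots> = 36 * r\<^sup>2 * (V / (q * (1 - q)))"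
      by (simp add: r_def power2_eq_square ac_simps)
    also have "V / (q * (1 - q)) = \<mu> / q" using q by (simp add: V_def)
    also have "36 * r\<^sup>2 * (\<mu> / q) \<le> 36 * r\<^sup>2 * (4 / 3)"
      using q by (intro mult_left_mono) (auto simp: divide_le_eq)
    also have "\<dots> \<le> (7 * r)\<^sup>2" by (simp add: power_mult_distrib)
    finally show "(\<beta> / s * (3 / sqrt k))\<^sup>2 \<le> (7 * r)\<^sup>2" .
  qed (use r in simp)
  have "(\<Sum>n\<in>{1..<T}. \<Sum>j | real j \<le> real n * q. pr n j)
      \<le> (\<Sum>n\<in>{1..<T}. (1 + 1 / s) * exp (- (real n * w)) + exp (- (real n * k))
            + \<beta> / s * (exp (- (real n * k)) / sqrt (real n)))"
    by (intro sum_mono inner) auto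
  also have "\<dots> = (1 + 1 / s) * (\<Sum>n\<in>{1..<T}. exp (- (real n * w))) + (\<Sum>n\<in>{1..<T}. exp (- (real n * k)))
      + \<beta> / s * (\<Sum>n\<in>{1..<T}. exp (- (real n * k)) / sqrt (real n))"
    by (simp add: sum.distrib sum_distrib_left)
  also have "\<dots> \<le> (1 + 1 / s) * (1 / w) + 1 / k + \<beta> / s * (3 / sqrt k)"
    using s w k \<beta> by (intro add_mono mult_left_mono sum_exp_le sum_exp_div_sqrt_le) auto
  also have "\<dots> \<le> 14 * r" using t1 t3 inv_k by simp
  finally show ?thesis by (simp add: pr_def r_def V_def \<epsilon>_def)
qed

definition weighted_lower_tail :: "real \<Rightarrow> nat \<Rightarrow> real \<Rightarrow> ennreal" where
  "weighted_lower_tail q n S =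
     (if 0 \<le> S \<and> S \<le> real n * q then ennreal (exp (real n * kl (S / real n) q)) else 0)"

lemma kl_measurable [measurable]:
  assumes [measurable]: "f \<in> borel_measurable M" "g \<in> borel_measurable M"
  shows "(\<lambda>x. kl (f x) (g x)) \<in> borel_measurable M"
  unfolding kl_def by measurable

context unit_prob begin

text \<open>The truncated exponential equals 1 above \<open>q\<close>, and summing that over
  \<open>n\<close> would grow with \<open>T\<close>. Subtracting 1 yields \<open>\<psi>\<close>,
  still convex and zero above \<open>q\<close>, so the binomial sum stops at \<open>n q\<close>. The
  missing 1 on the event \<open>S <= n q\<close> is an ordinary lower tail, and
  \<open>18 = 4 + 14\<close>.\<close>

lemma weighted_lower_tail_sum_le:
  assumes q: "0 < q" "q < \<mu>" "3 / 4 * \<mu> \<le> q" and v: "\<mu> * (1 - \<mu>) + (\<mu> - q) \<le> v"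
  shows "(\<Sum>n\<in>{1..<T}. walk \<nu> n (weighted_lower_tail q n) 0) \<le> ennreal (18 * v / (\<mu> - q)\<^sup>2)"
proof -
  have \<mu>1: "\<mu> \<le> 1" using mean_unit by simp
  have q01: "q \<in> {0<..<1}" using q \<mu>1 by simp
  define \<psi> where "\<psi> n S = exp (real n * kl (min (S / real n) q) q) - 1" for n S
  define G where "G n = (\<Sum>j | real j \<le> real n * q.
            real (n choose j) * \<mu> ^ j * (1 - \<mu>) ^ (n - j) * exp (real n * kl (real j / real n) q))" for n
  have \<psi>_meas [measurable]: "(\<lambda>S. max 0 (\<psi> n S)) \<in> borel_measurable borel" for n
    unfolding \<psi>_def by measurable
  have split: "walk \<nu> n (weighted_lower_tail q n) 0
      \<le> walk \<nu> n (indicator {S. real n * (\<mu> - q) \<le> - 1 * (S - real n * \<mu>)}) 0 + ennreal (G n)"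
    if n: "1 \<le> n" for n
  proof -
    have \<psi>0: "0 \<le> \<psi> n S" if "0 \<le> S" "S \<le> real n" for S
      using kl_nonneg[of "min (S / real n) q" q] that n q01 by (auto simp: \<psi>_def min_def)
    have "walk \<nu> n (weighted_lower_tail q n) 0
       \<le> walk \<nu> n (\<lambda>S. indicator {S. real n * (\<mu> - q) \<le> - 1 * (S - real n * \<mu>)} S + ennreal (max 0 (\<psi> n S))) 0"
    proof (rule walk_mono)
      fix S :: real
      show "weighted_lower_tail q n S
        \<le> indicator {S. real n * (\<mu> - q) \<le> - 1 * (S - real n * \<mu>)} S + ennreal (max 0 (\<psi> n S))"
      proof (cases "0 \<le> S \<and> S \<le> real n * q")
        case True
        then have "S / real n \<le> q" using n by (simp add: divide_le_eq mult.commute)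
        then have "exp (real n * kl (S / real n) q) = 1 + \<psi> n S" by (simp add: \<psi>_def)
        also have "\<dots> \<le> 1 + max 0 (\<psi> n S)" by simp
        finally have "ennreal (exp (real n * kl (S / real n) q)) \<le> 1 + ennreal (max 0 (\<psi> n S))"
          using ennreal_leI[of _ "1 + max 0 (\<psi> n S)"] by (subst (asm) ennreal_plus) auto
        moreover have "indicator {S. real n * (\<mu> - q) \<le> - 1 * (S - real n * \<mu>)} S = (1::ennreal)"
          using True by (simp add: algebra_simps)
        ultimately show ?thesis using True by (simp add: weighted_lower_tail_def)
      next
        case False
        then show ?thesis by (auto simp: weighted_lower_tail_def)
      qed
    qed
    also have "\<dots> = walk \<nu> n (indicator {S. real n * (\<mu> - q) \<le> - 1 * (S - real n * \<mu>)}) 0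
        + walk \<nu> n (\<lambda>S. ennreal (max 0 (\<psi> n S))) 0"
      by (intro walk_add) measurable
    also have "walk \<nu> n (\<lambda>S. ennreal (max 0 (\<psi> n S))) 0 \<le> ennreal (bin_mean \<mu> n (\<lambda>S. max 0 (\<psi> n S)) 0)"
    proof (rule walk_le_bin_mean[where N = "real n"])
      show "convex_on {0..real n} (\<lambda>S. max 0 (\<psi> n S))"
      proof (rule convex_onI)
        fix t x y :: real assume *: "0 < t" "t < 1" "x \<in> {0..real n}" "y \<in> {0..real n}"
        have "(1 - t) * x + t * y \<le> (1 - t) * real n + t * real n"
          using * by (intro add_mono mult_left_mono) auto
        then have z: "(1 - t) * x + t * y \<le> real n" by (simp add: algebra_simps)
        have "0 \<le> (1 - t) * x + t * y" using * by (intro add_nonneg_nonneg mult_nonneg_nonneg) auto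
        note z = this z
        define F where "F w = exp (real n * kl (min (w / real n) q) q)" for w
        have "F ((1 - t) * x + t * y) \<le> (1 - t) * F x + t * F y"
          using convex_onD[OF exp_kl_convex[OF q01, of n], of t "x / real n" "y / real n"] * n
          by (simp add: F_def add_divide_distrib)
        moreover have "\<psi> n w = F w - 1" for w by (simp add: F_def \<psi>_def)
        ultimately have "\<psi> n ((1 - t) * x + t * y) \<le> (1 - t) * \<psi> n x + t * \<psi> n y"
          by (simp add: right_diff_distrib)
        then show "max 0 (\<psi> n ((1 - t) *\<^sub>R x + t *\<^sub>R y)) \<le> (1 - t) * max 0 (\<psi> n x) + t * max 0 (\<psi> n y)"
          using \<psi>0[OF z] \<psi>0[of x] \<psi>0[of y] * by simp
      qed simp
    qed auto
    also have "bin_mean \<mu> n (\<lambda>S. max 0 (\<psi> n S)) 0 \<le> G n"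
    proof -
      have "bin_mean \<mu> n (\<lambda>S. max 0 (\<psi> n S)) 0
        \<le> (\<Sum>j\<le>n. if real j \<le> real n * q then
          real (n choose j) * \<mu> ^ j * (1 - \<mu>) ^ (n - j) * exp (real n * kl (real j / real n) q) else 0)"
        unfolding bin_mean_def
      proof (rule sum_mono)
        fix j assume j: "j \<in> {..n}"
        have c: "0 \<le> real (n choose j) * \<mu> ^ j * (1 - \<mu>) ^ (n - j)" using mean_unit by simp
        have "max 0 (\<psi> n (0 + real j)) \<le> (if real j \<le> real n * q then exp (real n * kl (real j / real n) q) else 0)"
          using n by (auto simp: \<psi>_def min_def field_simps)
        from mult_left_mono[OF this c]
        show "real (n choose j) * \<mu> ^ j * (1 - \<mu>) ^ (n - j) * max 0 (\<psi> n (0 + real j))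
           \<le> (if real j \<le> real n * q then
          real (n choose j) * \<mu> ^ j * (1 - \<mu>) ^ (n - j) * exp (real n * kl (real j / real n) q) else 0)"
          by (simp split: if_splits)
      qed
      also have "\<dots> = G n"
      proof -
        have "{j. real j \<le> real n * q} = {..n} \<inter> {j. real j \<le> real n * q}"
          using mult_left_le[of q "real n"] q01 by (auto intro: order_trans)
        then have "G n = (\<Sum>j\<in>{..n} \<inter> {j. real j \<le> real n * q}.
            real (n choose j) * \<mu> ^ j * (1 - \<mu>) ^ (n - j) * exp (real n * kl (real j / real n) q))"
          unfolding G_def by (rule arg_cong)
        then show ?thesis by (simp add: sum.inter_restrict)
      qed
      finally show ?thesis .
    qed
    finally show ?thesis by (simp add: ennreal_leI)
  qed
  have G0: "0 \<le> G n" for n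
    unfolding G_def using mean_unit by (intro sum_nonneg) auto
  have Gsum: "(\<Sum>n\<in>{1..<T}. G n) \<le> 14 * v / (\<mu> - q)\<^sup>2"
  proof (cases "\<mu> = 1")
    \<comment> \<open>For \<open>\<mu> = 1\<close> the binomial law sits at \<open>n\<close>, beyond
      \<open>n q\<close>, so every term vanishes.\<close>
    case True
    have "(\<Sum>n\<in>{1..<T}. G n) = 0"
    proof (intro sum.neutral ballI)
      fix n assume n: "n \<in> {1..<T}"
      have "j < n" if "real j \<le> real n * q" for j
      proof -
        have "real n * q < real n * 1" using n q01 by (intro mult_strict_left_mono) auto
        then show ?thesis using that by simp
      qed
      then show "G n = 0" unfolding G_def True by (intro sum.neutral) auto
    qed
    moreover have "0 \<le> v" using v True q01 by simp
    ultimately show ?thesis by simp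
  next
    case False
    then have "(\<Sum>n\<in>{1..<T}. G n) \<le> 14 * (\<mu> * (1 - q) / (\<mu> - q)\<^sup>2)"
      unfolding G_def using q \<mu>1 by (intro binomial_tilted_sum_le) auto
    also have "\<mu> * (1 - q) \<le> v"
    proof -
      have "\<mu> * (\<mu> - q) \<le> 1 * (\<mu> - q)" using \<mu>1 q by (intro mult_right_mono) auto
      then show ?thesis using v by (simp add: algebra_simps)
    qed
    finally show ?thesis by (simp add: divide_right_mono)
  qed
  have "(\<Sum>n\<in>{1..<T}. walk \<nu> n (weighted_lower_tail q n) 0)
     \<le> (\<Sum>n\<in>{1..<T}. walk \<nu> n (indicator {S. real n * (\<mu> - q) \<le> - 1 * (S - real n * \<mu>)}) 0 + ennreal (G n))"
    by (intro sum_mono split) auto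
  also have "\<dots> = (\<Sum>n\<in>{1..<T}. walk \<nu> n (indicator {S. real n * (\<mu> - q) \<le> - 1 * (S - real n * \<mu>)}) 0)
      + ennreal (\<Sum>n\<in>{1..<T}. G n)"
    by (simp add: sum.distrib sum_ennreal G0)
  also have "\<dots> \<le> ennreal (4 * v / (\<mu> - q)\<^sup>2) + ennreal (14 * v / (\<mu> - q)\<^sup>2)"
  proof (intro add_mono tail_sum_le ennreal_leI Gsum)
    have "0 \<le> \<mu> * (1 - \<mu>)" using mean_unit by simp
    then show "\<mu> - q \<le> v" "\<mu> * (1 - \<mu>) \<le> v" using v q by auto
  qed (use q in auto)
  also have "\<dots> = ennreal (18 * v / (\<mu> - q)\<^sup>2)"
  proof -
    have "0 \<le> \<mu> * (1 - \<mu>)" using mean_unit by simp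
    then have "0 \<le> v" using v q by auto
    then show ?thesis by (simp flip: ennreal_plus add: add_divide_distrib[symmetric])
  qed
  finally show ?thesis .
qed

end

section \<open>The history process\<close>

definition rsum :: "nat \<Rightarrow> history \<Rightarrow> nat \<Rightarrow> real" where
  "rsum t h a = (\<Sum>s\<in>{1..<t}. if fst (h s) = a then snd (h s) else 0)"

lemma muhat_eq: "muhat t h a = rsum t h a / real (npulls t h a)"
  by (simp add: muhat_def rsum_def)

lemma npulls_eq_sum: "npulls t h a = (\<Sum>s\<in>{1..<t}. if fst (h s) = a then 1 else 0)"
  unfolding npulls_def by (simp flip: sum.inter_filter)

text \<open>The conditional probability of each arm as a real function of the history; it turns
  integrals against \<open>klms_policy\<close> into finite sums.\<close>

definition pull_prob :: "nat \<Rightarrow> nat \<Rightarrow> history \<Rightarrow> nat \<Rightarrow> real" where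
  "pull_prob K t h a = (if t \<le> K then (if a = t then 1 else 0)
     else klms_weight K t h a / (\<Sum>b\<in>{1..K}. klms_weight K t h b))"

lemma klms_weight_nonneg: "0 \<le> klms_weight K t h a"
  by (simp add: klms_weight_def)

text \<open>An arm attaining the maximal empirical mean has weight \<open>exp 0\<close>, even if
  that mean is 0 or 1.\<close>

lemma one_le_sum_klms_weight:
  assumes "1 \<le> K" shows "1 \<le> (\<Sum>b\<in>{1..K}. klms_weight K t h b)"
proof -
  have "muhat_max K t h \<in> muhat t h ` {1..K}"
    unfolding muhat_max_def using assms by (intro Max_in) auto
  then obtain b where b: "b \<in> {1..K}" "muhat t h b = muhat_max K t h" by auto
  then have "1 = klms_weight K t h b" by (auto simp: klms_weight_def kl_infinite_def)
  also have "\<dots> \<le> (\<Sum>b\<in>{1..K}. klms_weight K t h b)"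
    using b by (intro member_le_sum klms_weight_nonneg) auto
  finally show ?thesis .
qed

lemma pull_prob_nonneg: "0 \<le> pull_prob K t h a"
  unfolding pull_prob_def by (auto intro!: divide_nonneg_nonneg sum_nonneg klms_weight_nonneg)

lemma sum_pull_prob:
  assumes "1 \<le> K" "1 \<le> t" shows "(\<Sum>a\<in>{1..K}. pull_prob K t h a) = 1"
proof (cases "t \<le> K")
  case False
  then have "(\<Sum>a\<in>{1..K}. pull_prob K t h a)
      = (\<Sum>b\<in>{1..K}. klms_weight K t h b) / (\<Sum>b\<in>{1..K}. klms_weight K t h b)"
    by (simp only: pull_prob_def if_False sum_divide_distrib)
  then show ?thesis using one_le_sum_klms_weight[OF assms(1), of t h] by simp
qed (use assms in \<open>simp add: pull_prob_def\<close>)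

lemma sum_ennreal_pull_prob:
  assumes "1 \<le> K" "1 \<le> t" shows "(\<Sum>a\<in>{1..K}. ennreal (pull_prob K t h a)) = 1"
  using sum_pull_prob[OF assms] by (simp add: sum_ennreal pull_prob_nonneg)

lemma npulls_upd: "t \<le> r \<Longrightarrow> npulls t (h(r := x)) a = npulls t h a"
  unfolding npulls_eq_sum by (intro sum.cong) auto

lemma rsum_upd: "t \<le> r \<Longrightarrow> rsum t (h(r := x)) a = rsum t h a"
  unfolding rsum_def by (intro sum.cong) auto

lemma npulls_Suc: "1 \<le> t \<Longrightarrow> npulls (Suc t) h a = npulls t h a + (if fst (h t) = a then 1 else 0)"
  unfolding npulls_eq_sum by simp

lemma rsum_Suc: "1 \<le> t \<Longrightarrow> rsum (Suc t) h a = rsum t h a + (if fst (h t) = a then snd (h t) else 0)"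
  unfolding rsum_def by simp

lemma pull_prob_upd:
  assumes "t \<le> r" shows "pull_prob K t (h(r := x)) a = pull_prob K t h a"
proof -
  have "muhat t (h(r := x)) = muhat t h"
    using assms by (auto simp: muhat_eq npulls_upd rsum_upd)
  then have "klms_weight K t (h(r := x)) = klms_weight K t h"
    using assms by (auto simp: klms_weight_def muhat_max_def npulls_upd)
  then show ?thesis by (simp add: pull_prob_def)
qed

lemma component_measurable_hist [measurable]:
  "s \<in> {1..t} \<Longrightarrow> (\<lambda>h. h s) \<in> measurable (hist_space t) (count_space UNIV \<Otimes>\<^sub>M borel)"
  unfolding hist_space_def by measurable

lemma fst_measurable_hist:
  "s \<in> {1..t} \<Longrightarrow> (\<lambda>h. fst (h s)) \<in> measurable (hist_space t) (count_space UNIV)"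
  by measurable

lemma snd_measurable_hist:
  "s \<in> {1..t} \<Longrightarrow> (\<lambda>h. snd (h s)) \<in> borel_measurable (hist_space t)"
  by measurable

lemma rsum_measurable [measurable]:
  assumes "s \<le> Suc t" shows "(\<lambda>h. rsum s h a) \<in> borel_measurable (hist_space t)"
proof -
  have [measurable]: "i \<in> {1..<s} \<Longrightarrow> (\<lambda>h. fst (h i)) \<in> measurable (hist_space t) (count_space UNIV)"
    "i \<in> {1..<s} \<Longrightarrow> (\<lambda>h. snd (h i)) \<in> borel_measurable (hist_space t)" for i
    using assms by (auto intro!: fst_measurable_hist snd_measurable_hist)
  show ?thesis unfolding rsum_def by measurable
qed

lemma npulls_measurable [measurable]:
  assumes "s \<le> Suc t" shows "(\<lambda>h. npulls s h a) \<in> measurable (hist_space t) (count_space UNIV)"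
proof -
  have [measurable]: "i \<in> {1..<s} \<Longrightarrow> (\<lambda>h. fst (h i)) \<in> measurable (hist_space t) (count_space UNIV)" for i
    using assms by (auto intro!: fst_measurable_hist)
  show ?thesis unfolding npulls_eq_sum by measurable
qed

lemma pull_prob_measurable [measurable]:
  assumes "s \<le> Suc t" shows "(\<lambda>h. pull_prob K s h a) \<in> borel_measurable (hist_space t)"
proof -
  note [measurable] = npulls_measurable[OF assms] rsum_measurable[OF assms]
  have [measurable]: "(\<lambda>h. muhat s h b) \<in> borel_measurable (hist_space t)" for b
    unfolding muhat_eq by measurable
  have [measurable]: "(\<lambda>h. muhat_max K s h) \<in> borel_measurable (hist_space t)"
    unfolding muhat_max_def by (intro borel_measurable_Max) auto
  have [measurable]: "(\<lambda>h. klms_weight K s h b) \<in> borel_measurable (hist_space t)" for b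
    unfolding klms_weight_def kl_infinite_def by measurable
  show ?thesis unfolding pull_prob_def by measurable
qed

lemma sets_klms_policy [simp, measurable_cong]: "sets (klms_policy K t h) = sets (count_space UNIV)"
  by (simp add: klms_policy_def)

lemma space_klms_policy [simp]: "space (klms_policy K t h) = UNIV"
  by (simp add: klms_policy_def)

lemma nn_integral_klms_policy:
  assumes "1 \<le> t"
  shows "(\<integral>\<^sup>+a. F a \<partial>klms_policy K t h) = (\<Sum>a\<in>{1..K}. ennreal (pull_prob K t h a) * F a)"
proof (cases "t \<le> K")
  case True
  then have "(\<integral>\<^sup>+a. F a \<partial>klms_policy K t h) = F t"
    by (simp add: klms_policy_def nn_integral_return)
  also have "F t = (\<Sum>a\<in>{1..K}. if a = t then F a else 0)" using True assms by simp
  also have "\<dots> = (\<Sum>a\<in>{1..K}. ennreal (pull_prob K t h a) * F a)"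
    using True by (intro sum.cong) (auto simp: pull_prob_def)
  finally show ?thesis .
next
  case False
  then have "(\<integral>\<^sup>+a. F a \<partial>klms_policy K t h) =
     (\<integral>\<^sup>+a. ennreal (if a \<in> {1..K} then pull_prob K t h a else 0) * F a \<partial>count_space UNIV)"
    by (simp add: klms_policy_def nn_integral_density pull_prob_def cong: if_cong)
  also have "\<dots> = (\<Sum>a\<in>{1..K}. ennreal (if a \<in> {1..K} then pull_prob K t h a else 0) * F a)"
    by (intro nn_integral_count_space'[where A = "{1..K}"]) (auto simp: not_le)
  finally show ?thesis by simp
qed

lemma prob_space_klms_policy:
  assumes "1 \<le> K" "1 \<le> t" shows "prob_space (klms_policy K t h)"
proof
  have "emeasure (klms_policy K t h) UNIV = (\<integral>\<^sup>+a. 1 \<partial>klms_policy K t h)" by simp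
  also have "\<dots> = 1" by (simp only: nn_integral_klms_policy[OF assms(2)] mult_1_right sum_ennreal_pull_prob[OF assms])
  finally show "emeasure (klms_policy K t h) (space (klms_policy K t h)) = 1" by simp
qed

lemma klms_policy_measurable:
  assumes "1 \<le> K" 
  shows "(\<lambda>h. klms_policy K (Suc t) h) \<in> measurable (hist_space t) (subprob_algebra (count_space UNIV))"
proof (rule measurable_subprob_algebra)
  fix A :: "nat set" 
  have "emeasure (klms_policy K (Suc t) h) A = (\<Sum>a\<in>{1..K}. ennreal (pull_prob K (Suc t) h a) * indicator A a)" for h
    using nn_integral_klms_policy[of "Suc t" K h "indicator A"] by (subst nn_integral_indicator[symmetric]) auto
  then show "(\<lambda>h. emeasure (klms_policy K (Suc t) h) A) \<in> borel_measurable (hist_space t)"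
    by simp
qed (use assms in \<open>auto intro!: prob_space_imp_subprob_space prob_space_klms_policy\<close>)

text \<open>The reward distributions of arms outside \<open>{1..K}\<close> are arbitrary measures, so the kernels in the
definition of \<^const>\<open>klms_hist\<close> need not be measurable into the subprobability measures.  On a
discrete space the monadic bind nevertheless depends on the kernel only almost everywhere.\<close>

lemma bind_cong_discrete:
  assumes sets: "sets M = UNIV" and AE: "AE x in M. f x = g x"
    and "\<And>x. sets (f x) = sets N" "\<And>x. sets (g x) = sets N"
  shows "M \<bind> f = M \<bind> g"
proof -
  have sp: "space M = UNIV" using sets sets.top[of M] sets.sets_into_space[of UNIV M] by auto
  have *: "subprob_algebra (f (SOME x. x \<in> space M)) = subprob_algebra N"
    "subprob_algebra (g (SOME x. x \<in> space M)) = subprob_algebra N"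
    using assms by (auto intro: subprob_algebra_cong)
  have "emeasure M (f -` A) = emeasure M (g -` A)" for A
    by (rule emeasure_eq_AE) (use AE sets in auto)
  then have "distr M (subprob_algebra N) f = distr M (subprob_algebra N) g"
    unfolding distr_def sp by simp
  then show ?thesis unfolding bind_def * by simp
qed

lemma hist_space_upd_measurable:
  "(\<lambda>((h, a), y). h(Suc t := (a, y)))
     \<in> measurable ((hist_space t \<Otimes>\<^sub>M count_space UNIV) \<Otimes>\<^sub>M borel) (hist_space (Suc t))"
proof -
  have *: "(\<lambda>w. (fst (fst w))(Suc t := (snd (fst w), snd w)))
     \<in> measurable ((hist_space t \<Otimes>\<^sub>M count_space UNIV) \<Otimes>\<^sub>M borel) (hist_space (Suc t))"
    unfolding hist_space_def
    by (rule measurable_fun_upd[where J = "{1..t}"]) (auto simp: atLeastAtMostSuc_conv)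
  show ?thesis using * by (simp add: case_prod_beta')
qed

section \<open>The law of the history, round by round\<close>

locale klms =
  fixes nu :: "nat \<Rightarrow> real measure" and K :: nat
  assumes K: "1 \<le> K" and arm: "\<And>a. a \<in> {1..K} \<Longrightarrow> unit_prob (nu a)"
begin

abbreviation "hist \<equiv> klms_hist nu K"

text \<open>The zero measure outside \<open>{1..K}\<close> makes every arm a subprobability, so
  kernels built from \<open>nu'\<close> are measurable. \<open>hist_Suc\<close> exchanges
  \<open>nu\<close> for it, since those arms are almost surely never drawn.\<close>

definition nu' :: "nat \<Rightarrow> real measure" where
  "nu' a = (if a \<in> {1..K} then nu a else null_measure borel)"

lemma nu'_measurable: "nu' \<in> measurable (count_space UNIV) (subprob_algebra borel)"
proof -
  have "nu' a \<in> space (subprob_algebra borel)" for a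
  proof (cases "a \<in> {1..K}")
    case True
    interpret unit_prob "nu a" using arm[OF True] .
    show ?thesis using True by (simp add: nu'_def space_subprob_algebra subprob_space_axioms)
  next
    case False
    then show ?thesis by (auto simp: nu'_def space_subprob_algebra intro!: subprob_spaceI)
  qed
  then show ?thesis by simp
qed

definition step :: "nat \<Rightarrow> history \<Rightarrow> history measure" where
  "step t h = klms_policy K (Suc t) h \<bind> (\<lambda>a. distr (nu' a) (hist_space (Suc t)) (\<lambda>y. h(Suc t := (a, y))))"

lemma hist_Suc: "hist (Suc t) = hist t \<bind> step t"
proof -
  have "klms_policy K (Suc t) h \<bind> (\<lambda>a. distr (nu a) (hist_space (Suc t)) (\<lambda>y. h(Suc t := (a, y)))) = step t h" for h
    unfolding step_def
  proof (rule bind_cong_discrete[where N = "hist_space (Suc t)"])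
    have "(\<integral>\<^sup>+a. indicator (- {1..K}) a \<partial>klms_policy K (Suc t) h) = 0"
      by (subst nn_integral_klms_policy) auto
    then have "AE a in klms_policy K (Suc t) h. indicator (- {1..K}) a = (0::ennreal)"
      by (subst (asm) nn_integral_0_iff_AE) auto
    then show "AE a in klms_policy K (Suc t) h. distr (nu a) (hist_space (Suc t)) (\<lambda>y. h(Suc t := (a, y)))
       = distr (nu' a) (hist_space (Suc t)) (\<lambda>y. h(Suc t := (a, y)))"
      by eventually_elim (auto simp: nu'_def indicator_def split: if_splits)
  qed auto
  then show ?thesis by simp
qed

lemma distr_kernel_measurable:
  "(\<lambda>(h, a). distr (nu' a) (hist_space (Suc t)) (\<lambda>y. h(Suc t := (a, y))))
    \<in> measurable (hist_space t \<Otimes>\<^sub>M count_space UNIV) (subprob_algebra (hist_space (Suc t)))"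
proof -
  have "(\<lambda>x. distr (nu' (snd x)) (hist_space (Suc t)) ((\<lambda>x y. (fst x)(Suc t := (snd x, y))) x))
    \<in> measurable (hist_space t \<Otimes>\<^sub>M count_space UNIV) (subprob_algebra (hist_space (Suc t)))"
    by (rule measurable_distr2[where M = borel])
      (use hist_space_upd_measurable nu'_measurable in \<open>auto simp: case_prod_beta' intro: measurable_compose[OF measurable_snd]\<close>)
  then show ?thesis by (simp add: case_prod_beta')
qed

lemma step_measurable: "step t \<in> measurable (hist_space t) (subprob_algebra (hist_space (Suc t)))"
  unfolding step_def
  by (rule measurable_bind'[OF klms_policy_measurable[OF K] distr_kernel_measurable])

lemma upd_measurable:
  assumes "h \<in> space (hist_space t)"
  shows "(\<lambda>y. h(Suc t := (a, y))) \<in> measurable borel (hist_space (Suc t))"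
  using measurable_Pair2[OF hist_space_upd_measurable, of "(h, a)" t] assms
  by (simp add: space_pair_measure case_prod_beta')

lemma nn_integral_step:
  assumes h: "h \<in> space (hist_space t)" and F [measurable]: "F \<in> borel_measurable (hist_space (Suc t))"
  shows "(\<integral>\<^sup>+w. F w \<partial>step t h) =
    (\<Sum>a\<in>{1..K}. ennreal (pull_prob K (Suc t) h a) * (\<integral>\<^sup>+y. F (h(Suc t := (a, y))) \<partial>nu a))"
proof -
  note [measurable] = upd_measurable[OF h]
  have sets_nu': "sets (nu' a) = sets borel" for a
    using nu'_measurable by (auto simp: measurable_def space_subprob_algebra)
  have "(\<lambda>a. distr (nu' a) (hist_space (Suc t)) (\<lambda>y. h(Suc t := (a, y))))
      \<in> measurable (klms_policy K (Suc t) h) (subprob_algebra (hist_space (Suc t)))"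
    using measurable_Pair2[OF distr_kernel_measurable h]
    by (subst measurable_cong_sets[OF sets_klms_policy refl]) simp
  then have "(\<integral>\<^sup>+w. F w \<partial>step t h) =
     (\<integral>\<^sup>+a. \<integral>\<^sup>+w. F w \<partial>distr (nu' a) (hist_space (Suc t)) (\<lambda>y. h(Suc t := (a, y))) \<partial>klms_policy K (Suc t) h)"
    unfolding step_def by (rule nn_integral_bind[OF F])
  also have "\<dots> = (\<integral>\<^sup>+a. \<integral>\<^sup>+y. F (h(Suc t := (a, y))) \<partial>nu' a \<partial>klms_policy K (Suc t) h)"
    by (intro nn_integral_cong nn_integral_distr) (auto simp: measurable_cong_sets[OF sets_nu' refl] upd_measurable[OF h])
  also have "\<dots> = (\<Sum>a\<in>{1..K}. ennreal (pull_prob K (Suc t) h a) * (\<integral>\<^sup>+y. F (h(Suc t := (a, y))) \<partial>nu a))"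
    by (subst nn_integral_klms_policy) (auto simp: nu'_def)
  finally show ?thesis .
qed

lemma prob_space_step: 
  assumes h: "h \<in> space (hist_space t)" shows "prob_space (step t h)"
proof
  have s: "sets (step t h) = sets (hist_space (Suc t))"
    using sets_kernel[OF step_measurable h] .
  have "emeasure (step t h) (space (step t h)) = (\<integral>\<^sup>+w. 1 \<partial>step t h)" by simp
  also have "\<dots> = (\<Sum>a\<in>{1..K}. ennreal (pull_prob K (Suc t) h a) * 1)"
    unfolding nn_integral_step[OF h borel_measurable_const]
  proof (intro sum.cong refl arg_cong2[where f = "(*)"])
    fix a assume "a \<in> {1..K}"
    then interpret unit_prob "nu a" by (rule arm)
    show "(\<integral>\<^sup>+y. 1 \<partial>nu a) = 1" by (simp add: emeasure_space_1)
  qed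
  also have "\<dots> = 1" using sum_ennreal_pull_prob[OF K, of "Suc t" h] by simp
  finally show "emeasure (step t h) (space (step t h)) = 1" .
qed

lemma hist_prob_sets: "prob_space (hist t) \<and> sets (hist t) = sets (hist_space t)"
proof (induction t)
  case 0
  have "(\<lambda>_. undefined) \<in> space (hist_space 0)" by (simp add: hist_space_def space_PiM)
  then show ?case by (simp add: prob_space_return)
next
  case (Suc t)
  interpret prob_space "hist t" using Suc by simp
  have sp: "space (hist t) = space (hist_space t)" using Suc by (intro sets_eq_imp_space_eq) simp
  have m: "step t \<in> measurable (hist t) (subprob_algebra (hist_space (Suc t)))"
    using step_measurable Suc by (simp cong: measurable_cong_sets)
  have "prob_space (hist (Suc t))" unfolding hist_Suc
    by (rule prob_space_bind[OF _ m]) (auto simp: sp intro!: AE_I2 prob_space_step)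
  moreover have "sets (hist (Suc t)) = sets (hist_space (Suc t))"
    unfolding hist_Suc by (rule sets_bind[OF sets_kernel[OF m] not_empty])
  ultimately show ?case by simp
qed

lemma sets_hist [simp, measurable_cong]: "sets (hist t) = sets (hist_space t)"
  using hist_prob_sets by simp

lemma space_hist [simp]: "space (hist t) = space (hist_space t)"
  by (rule sets_eq_imp_space_eq) simp

sublocale hist: prob_space "hist t" for t
  using hist_prob_sets by simp

lemma nn_integral_hist_Suc:
  assumes F: "F \<in> borel_measurable (hist_space (Suc t))"
  shows "(\<integral>\<^sup>+h. F h \<partial>hist (Suc t)) = (\<integral>\<^sup>+h. (\<Sum>a\<in>{1..K}. ennreal (pull_prob K (Suc t) h a)
            * (\<integral>\<^sup>+y. F (h(Suc t := (a, y))) \<partial>nu a)) \<partial>hist t)"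
proof -
  have m: "step t \<in> measurable (hist t) (subprob_algebra (hist_space (Suc t)))"
    using step_measurable by (simp cong: measurable_cong_sets)
  show ?thesis unfolding hist_Suc nn_integral_bind[OF F m]
    by (intro nn_integral_cong nn_integral_step F) simp
qed



lemma nn_integral_arm_const:
  assumes "a \<in> {1..K}" shows "(\<integral>\<^sup>+y. C \<partial>nu a) = C"
proof -
  interpret unit_prob "nu a" using arm[OF assms] .
  show ?thesis by (simp add: emeasure_space_1)
qed

lemma sum_pull_prob_const: "(\<Sum>a\<in>{1..K}. ennreal (pull_prob K (Suc t) h a) * C) = C"
  using sum_ennreal_pull_prob[OF K, of "Suc t" h] by (simp add: sum_distrib_right[symmetric])

lemma sum_pull_prob_le:
  assumes "\<And>a. a \<in> {1..K} \<Longrightarrow> f a \<le> C"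
  shows "(\<Sum>a\<in>{1..K}. ennreal (pull_prob K (Suc t) h a) * f a) \<le> C"
proof -
  have "(\<Sum>a\<in>{1..K}. ennreal (pull_prob K (Suc t) h a) * f a)
     \<le> (\<Sum>a\<in>{1..K}. ennreal (pull_prob K (Suc t) h a) * C)"
    by (intro sum_mono mult_left_mono assms) auto
  then show ?thesis by (simp only: sum_pull_prob_const)
qed

lemma sum_pull_prob_add:
  "(\<Sum>a\<in>{1..K}. ennreal (pull_prob K (Suc t) h a) * (C + f a))
     = C + (\<Sum>a\<in>{1..K}. ennreal (pull_prob K (Suc t) h a) * f a)"
  by (simp only: distrib_left sum.distrib sum_pull_prob_const)

section \<open>Almost sure properties and expected costs along a run\<close>

definition good :: "nat \<Rightarrow> history \<Rightarrow> bool" where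
  "good t h \<longleftrightarrow> (\<forall>s\<in>{1..t}. fst (h s) \<in> {1..K} \<and> snd (h s) \<in> {0..1} \<and> (s \<le> K \<longrightarrow> fst (h s) = s))"

lemma good_measurable [measurable]: "Measurable.pred (hist_space t) (good t)"
proof -
  note [measurable] = fst_measurable_hist snd_measurable_hist
  show ?thesis unfolding good_def atLeastAtMost_iff by measurable
qed

lemma AE_good: "AE h in hist t. good t h"
proof -
  have "(\<integral>\<^sup>+h. indicator {h. \<not> good t h} h \<partial>hist t) = 0"
  proof (induction t)
    case 0 then show ?case by (simp add: good_def)
  next
    case (Suc t)
    have [measurable]: "(\<lambda>h. indicator {h. \<not> good u h} h :: ennreal) \<in> borel_measurable (hist_space u)" for u
      by (auto simp: indicator_def)
    have "(\<integral>\<^sup>+h. indicator {h. \<not> good (Suc t) h} h \<partial>hist (Suc t))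
      = (\<integral>\<^sup>+h. (\<Sum>a\<in>{1..K}. ennreal (pull_prob K (Suc t) h a)
            * (\<integral>\<^sup>+y. indicator {h. \<not> good (Suc t) h} (h(Suc t := (a, y))) \<partial>nu a)) \<partial>hist t)"
      by (rule nn_integral_hist_Suc) measurable
    also have "\<dots> \<le> (\<integral>\<^sup>+h. indicator {h. \<not> good t h} h \<partial>hist t)"
    proof (intro nn_integral_mono)
      fix h
      have "ennreal (pull_prob K (Suc t) h a) * (\<integral>\<^sup>+y. indicator {h. \<not> good (Suc t) h} (h(Suc t := (a, y))) \<partial>nu a)
        \<le> ennreal (pull_prob K (Suc t) h a) * indicator {h. \<not> good t h} h" if a: "a \<in> {1..K}" for a
      proof (cases "Suc t \<le> K \<and> a \<noteq> Suc t")
        case True then show ?thesis by (simp add: pull_prob_def)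
      next
        case False
        interpret unit_prob "nu a" using arm[OF a] .
        have "(\<integral>\<^sup>+y. indicator {h. \<not> good (Suc t) h} (h(Suc t := (a, y))) \<partial>nu a)
          \<le> (\<integral>\<^sup>+y. indicator {h. \<not> good t h} h \<partial>nu a)"
          using AE_unit
        proof (intro nn_integral_mono_AE, eventually_elim)
          case (elim y)
          have "good (Suc t) (h(Suc t := (a, y)))" if "good t h"
            using that False a elim by (auto simp: good_def atLeastAtMostSuc_conv)
          then show ?case by (auto simp: indicator_def)
        qed
        also have "\<dots> = indicator {h. \<not> good t h} h" by (rule nn_integral_arm_const[OF a])
        finally show ?thesis by (rule mult_left_mono) simp
      qed
      then have "(\<Sum>a\<in>{1..K}. ennreal (pull_prob K (Suc t) h a)
            * (\<integral>\<^sup>+y. indicator {h. \<not> good (Suc t) h} (h(Suc t := (a, y))) \<partial>nu a))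
        \<le> (\<Sum>a\<in>{1..K}. ennreal (pull_prob K (Suc t) h a) * indicator {h. \<not> good t h} h)"
        by (rule sum_mono)
      then show "(\<Sum>a\<in>{1..K}. ennreal (pull_prob K (Suc t) h a)
            * (\<integral>\<^sup>+y. indicator {h. \<not> good (Suc t) h} (h(Suc t := (a, y))) \<partial>nu a))
        \<le> indicator {h. \<not> good t h} h"
        by (simp only: sum_pull_prob_const)
    qed
    finally show ?case using Suc by simp
  qed
  moreover have "(\<lambda>h. indicator {h. \<not> good t h} h :: ennreal) \<in> borel_measurable (hist t)"
    by (auto simp: indicator_def)
  ultimately have "AE h in hist t. indicator {h. \<not> good t h} h = (0::ennreal)"
    by (subst (asm) nn_integral_0_iff_AE) auto
  then show ?thesis by eventually_elim (auto simp: indicator_def split: if_splits)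
qed

lemma npulls_comp_measurable:
  assumes "s \<le> Suc t" "\<And>n. g n \<in> borel_measurable borel"
  shows "(\<lambda>h. g (npulls s h b) (rsum s h b)) \<in> borel_measurable (hist_space t)"
proof (rule measurable_compose_countable[where f = "\<lambda>n h. g n (rsum s h b)" and g = "\<lambda>h. npulls s h b"])
  show "(\<lambda>h. g n (rsum s h b)) \<in> borel_measurable (hist_space t)" for n
    by (rule measurable_compose[OF rsum_measurable[OF assms(1)] assms(2)])
qed (rule npulls_measurable[OF assms(1)])

text \<open>Given the past and the arm, a reward has the mean of that arm. Working with nonnegative
  integrals avoids integrability conditions; \<open>ennreal\<close> cuts off negative rewards, which
  have probability 0.\<close>

lemma reward_sum:
  "(\<integral>\<^sup>+h. (\<Sum>s\<in>{1..t}. ennreal (snd (h s))) \<partial>hist t)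
     = (\<integral>\<^sup>+h. (\<Sum>s\<in>{1..t}. ennreal (arm_mean nu (fst (h s)))) \<partial>hist t)"
proof (induction t)
  case (Suc t)
  have [measurable]: "(\<lambda>h. \<Sum>s\<in>{1..u}. ennreal (snd (h s))) \<in> borel_measurable (hist_space u)" 
    "(\<lambda>h. \<Sum>s\<in>{1..u}. ennreal (arm_mean nu (fst (h s)))) \<in> borel_measurable (hist_space u)" for u
    by measurable
  have [measurable]: "(\<lambda>h. pull_prob K (Suc t) h a) \<in> borel_measurable (hist_space t)" for a
    by (rule pull_prob_measurable) simp
  let ?C = "\<lambda>h. \<Sum>a\<in>{1..K}. ennreal (pull_prob K (Suc t) h a) * ennreal (arm_mean nu a)"
  have "(\<integral>\<^sup>+h. (\<Sum>s\<in>{1..Suc t}. ennreal (snd (h s))) \<partial>hist (Suc t))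
    = (\<integral>\<^sup>+h. (\<Sum>s\<in>{1..t}. ennreal (snd (h s))) + ?C h \<partial>hist t)"
    apply (subst nn_integral_hist_Suc, measurable)
    apply (subst sum_pull_prob_add[symmetric])
  proof (intro nn_integral_cong sum.cong refl arg_cong2[where f = "(*)"])
    fix h a assume a: "a \<in> {1..K}"
    interpret unit_prob "nu a" using arm[OF a] .
    have "(\<integral>\<^sup>+y. (\<Sum>s\<in>{1..Suc t}. ennreal (snd ((h(Suc t := (a, y))) s))) \<partial>nu a)
      = (\<integral>\<^sup>+y. (\<Sum>s\<in>{1..t}. ennreal (snd (h s))) + ennreal y \<partial>nu a)"
      by (intro nn_integral_cong) simp
    also have "\<dots> = (\<Sum>s\<in>{1..t}. ennreal (snd (h s))) + ennreal (arm_mean nu a)"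
      by (subst nn_integral_add) (auto simp: emeasure_space_1 nn_integral_id arm_mean_def)
    finally show "(\<integral>\<^sup>+y. (\<Sum>s\<in>{1..Suc t}. ennreal (snd ((h(Suc t := (a, y))) s))) \<partial>nu a) = \<dots>" .
  qed
  also have "\<dots> = (\<integral>\<^sup>+h. (\<Sum>s\<in>{1..t}. ennreal (snd (h s))) \<partial>hist t) + (\<integral>\<^sup>+h. ?C h \<partial>hist t)"
    by (rule nn_integral_add) measurable
  also have "\<dots> = (\<integral>\<^sup>+h. (\<Sum>s\<in>{1..t}. ennreal (arm_mean nu (fst (h s)))) + ?C h \<partial>hist t)"
    unfolding Suc by (rule nn_integral_add[symmetric]) measurable
  also have "\<dots> = (\<integral>\<^sup>+h. (\<Sum>s\<in>{1..Suc t}. ennreal (arm_mean nu (fst (h s)))) \<partial>hist (Suc t))"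
    apply (subst nn_integral_hist_Suc, measurable)
    apply (subst sum_pull_prob_add[symmetric])
  proof (intro nn_integral_cong sum.cong refl arg_cong2[where f = "(*)"])
    fix h a assume a: "a \<in> {1..K}"
    have "(\<Sum>s\<in>{1..Suc t}. ennreal (arm_mean nu (fst ((h(Suc t := (a, y))) s)))) 
       = (\<Sum>s\<in>{1..t}. ennreal (arm_mean nu (fst (h s)))) + ennreal (arm_mean nu a)" for y :: real
      by simp
    then show "(\<Sum>s\<in>{1..t}. ennreal (arm_mean nu (fst (h s)))) + ennreal (arm_mean nu a) =
        (\<integral>\<^sup>+y. (\<Sum>s\<in>{1..Suc t}. ennreal (arm_mean nu (fst ((h(Suc t := (a, y))) s)))) \<partial>nu a)"
      by (simp only: nn_integral_arm_const[OF a])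
  qed
  finally show ?case .
qed simp

text \<open>The cost of round \<open>s\<close> depends on earlier rounds only, by
  \<open>past\<close>, so the arm drawn may be averaged with its conditional probabilities. It is
  used both ways: pulls of \<open>a\<close> become probabilities, and weighted probabilities of arm
  1 become pulls again.\<close>

lemma compensator:
  assumes meas: "\<And>s t a. s \<le> Suc t \<Longrightarrow> \<phi> s a \<in> borel_measurable (hist_space t)"
    and past: "\<And>s a h r x. s \<le> r \<Longrightarrow> \<phi> s a (h(r := x)) = \<phi> s a h"
  shows "(\<integral>\<^sup>+h. (\<Sum>s\<in>{1..t}. \<phi> s (fst (h s)) h) \<partial>hist t)
    = (\<integral>\<^sup>+h. (\<Sum>s\<in>{1..t}. \<Sum>a\<in>{1..K}. ennreal (pull_prob K s h a) * \<phi> s a h) \<partial>hist t)"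
proof (induction t)
  case (Suc t)
  let ?X = "\<lambda>s h. \<phi> s (fst (h s)) h"
  let ?Y = "\<lambda>s h. \<Sum>a\<in>{1..K}. ennreal (pull_prob K s h a) * \<phi> s a h"
  have X: "?X s \<in> borel_measurable (hist_space u)" if "s \<in> {1..u}" for s u
    by (rule measurable_compose_countable[where f = "\<lambda>a h. \<phi> s a h" and g = "\<lambda>h. fst (h s)"])
      (use that in \<open>auto intro!: meas fst_measurable_hist\<close>)
  have Y: "?Y s \<in> borel_measurable (hist_space u)" if "s \<le> Suc u" for s u
    using meas[OF that] pull_prob_measurable[OF that] by measurable
  have sX: "(\<lambda>h. \<Sum>s\<in>{1..u}. ?X s h) \<in> borel_measurable (hist_space u)" for u
    using X by measurable
  have sY: "(\<lambda>h. \<Sum>s\<in>{1..u}. ?Y s h) \<in> borel_measurable (hist_space u)" for u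
    by (intro borel_measurable_sum Y) auto
  have "(\<integral>\<^sup>+h. (\<Sum>s\<in>{1..Suc t}. ?X s h) \<partial>hist (Suc t)) = (\<integral>\<^sup>+h. (\<Sum>s\<in>{1..t}. ?X s h) + ?Y (Suc t) h \<partial>hist t)"
    unfolding nn_integral_hist_Suc[OF sX] sum_pull_prob_add[symmetric]
  proof (intro nn_integral_cong sum.cong refl arg_cong2[where f = "(*)"])
    fix h a assume a: "a \<in> {1..K}"
    have "(\<Sum>s\<in>{1..Suc t}. ?X s (h(Suc t := (a, y)))) = (\<Sum>s\<in>{1..t}. ?X s h) + \<phi> (Suc t) a h" for y
      by (simp add: past)
    then show "(\<integral>\<^sup>+y. (\<Sum>s\<in>{1..Suc t}. ?X s (h(Suc t := (a, y)))) \<partial>nu a) = (\<Sum>s\<in>{1..t}. ?X s h) + \<phi> (Suc t) a h"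
      by (simp only: nn_integral_arm_const[OF a])
  qed
  also have "\<dots> = (\<integral>\<^sup>+h. (\<Sum>s\<in>{1..t}. ?X s h) \<partial>hist t) + (\<integral>\<^sup>+h. ?Y (Suc t) h \<partial>hist t)"
    using sX[of t] Y[of "Suc t" t] by (intro nn_integral_add) auto
  also have "\<dots> = (\<integral>\<^sup>+h. (\<Sum>s\<in>{1..t}. ?Y s h) + ?Y (Suc t) h \<partial>hist t)"
    unfolding Suc using sY[of t] Y[of "Suc t" t] by (intro nn_integral_add[symmetric]) auto
  also have "\<dots> = (\<integral>\<^sup>+h. (\<Sum>s\<in>{1..Suc t}. ?Y s h) \<partial>hist (Suc t))"
    unfolding nn_integral_hist_Suc[OF sY]
  proof (intro nn_integral_cong)
    fix h
    have "(\<Sum>s\<in>{1..Suc t}. ?Y s (h(Suc t := x))) = (\<Sum>s\<in>{1..t}. ?Y s h) + ?Y (Suc t) h" for x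
    proof -
      have "(\<Sum>s\<in>{1..Suc t}. ?Y s (h(Suc t := x))) = (\<Sum>s\<in>{1..Suc t}. ?Y s h)"
        by (intro sum.cong refl arg_cong2[where f = "(*)"]) (auto simp: past pull_prob_upd)
      then show ?thesis by simp
    qed
    then have "(\<Sum>a\<in>{1..K}. ennreal (pull_prob K (Suc t) h a) * (\<integral>\<^sup>+y. (\<Sum>s\<in>{1..Suc t}. ?Y s (h(Suc t := (a, y)))) \<partial>nu a))
       = (\<Sum>a\<in>{1..K}. ennreal (pull_prob K (Suc t) h a) * ((\<Sum>s\<in>{1..t}. ?Y s h) + ?Y (Suc t) h))"
      by (intro sum.cong refl arg_cong2[where f = "(*)"]) (simp only: nn_integral_arm_const)
    then show "(\<Sum>s\<in>{1..t}. ?Y s h) + ?Y (Suc t) h =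
       (\<Sum>a\<in>{1..K}. ennreal (pull_prob K (Suc t) h a) * (\<integral>\<^sup>+y. (\<Sum>s\<in>{1..Suc t}. ?Y s (h(Suc t := (a, y)))) \<partial>nu a))"
      by (simp only: sum_pull_prob_const)
  qed
  finally show ?case .
qed simp

text \<open>Read in the order of its pulls, arm \<open>b\<close> produces independent rewards,
  although the times of the pulls are adaptive. Each number \<open>n\<close> of earlier pulls is met
  at most once, and within \<open>T\<close> rounds it is below \<open>T\<close>; it need not be met
  at all, hence an inequality.\<close>

lemma arm_pulls_le_walk:
  assumes b: "b \<in> {1..K}" and g: "\<And>n. g n \<in> borel_measurable borel"
  shows "(\<integral>\<^sup>+h. (\<Sum>s\<in>{1..T}. if fst (h s) = b then g (npulls s h b) (rsum s h b) else 0) \<partial>hist T)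
    \<le> (\<Sum>n<T. walk (nu b) n (g n) 0)"
proof -
  interpret unit_prob "nu b" using arm[OF b] .
  \<comment> \<open>Potential: the expected cost of the next \<open>m\<close> pulls of \<open>b\<close> after \<open>n\<close> pulls with reward sum \<open>S\<close>.
    Accrued cost plus potential does not increase in expectation from round to round.\<close>
  define V where "V m n S = (\<Sum>i<m. walk (nu b) i (g (n + i)) S)" for m n S
  define A where "A t h = (\<Sum>s\<in>{1..t}. if fst (h s) = b then g (npulls s h b) (rsum s h b) else 0)" for t h
  note walk_g [measurable] = walk_measurable[OF g]
  have V_Suc: "V (Suc m) n S = g n S + (\<integral>\<^sup>+y. V m (Suc n) (S + y) \<partial>nu b)" for m n S
  proof -
    have "(\<integral>\<^sup>+y. V m (Suc n) (S + y) \<partial>nu b) = (\<Sum>i<m. walk (nu b) (Suc i) (g (Suc n + i)) S)"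
      unfolding V_def walk.simps by (rule nn_integral_sum) measurable
    then show ?thesis by (simp add: V_def sum.lessThan_Suc_shift del: sum.lessThan_Suc)
  qed
  have V_mono: "V m n S \<le> V (Suc m) n S" for m n S by (simp add: V_def)
  have V_meas: "V m n \<in> borel_measurable borel" for m n unfolding V_def by measurable
  have A_meas: "A t \<in> borel_measurable (hist_space t)" for t
    unfolding A_def
  proof (intro borel_measurable_sum measurable_If)
    fix s assume s: "s \<in> {1..t}"
    then show "(\<lambda>h. g (npulls s h b) (rsum s h b)) \<in> borel_measurable (hist_space t)"
      by (intro npulls_comp_measurable g) auto
    show "{h \<in> space (hist_space t). fst (h s) = b} \<in> sets (hist_space t)"
      using fst_measurable_hist[OF s] by measurable
  qed auto
  have "(\<integral>\<^sup>+h. A t h + V m (npulls (Suc t) h b) (rsum (Suc t) h b) \<partial>hist t) \<le> V (t + m) 0 0" for t m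
  proof (induction t arbitrary: m)
    case 0
    have "emeasure (hist 0) (space (hist_space 0)) = 1"
      using hist.emeasure_space_1[of 0] by (simp del: klms_hist.simps)
    then show ?case by (simp add: A_def npulls_eq_sum rsum_def del: klms_hist.simps)
  next
    case (Suc t)
    have "(\<integral>\<^sup>+h. A (Suc t) h + V m (npulls (Suc (Suc t)) h b) (rsum (Suc (Suc t)) h b) \<partial>hist (Suc t))
      = (\<integral>\<^sup>+h. (\<Sum>a\<in>{1..K}. ennreal (pull_prob K (Suc t) h a) * (\<integral>\<^sup>+y. A (Suc t) (h(Suc t := (a, y)))
       + V m (npulls (Suc (Suc t)) (h(Suc t := (a, y))) b) (rsum (Suc (Suc t)) (h(Suc t := (a, y))) b) \<partial>nu a)) \<partial>hist t)"
      by (intro nn_integral_hist_Suc borel_measurable_add A_meas npulls_comp_measurable V_meas) simp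
    also have "\<dots> \<le> (\<integral>\<^sup>+h. A t h + V (Suc m) (npulls (Suc t) h b) (rsum (Suc t) h b) \<partial>hist t)"
    proof (intro nn_integral_mono sum_pull_prob_le)
      fix h a assume a: "a \<in> {1..K}"
      have old: "A t (h(Suc t := x)) = A t h" for x
        unfolding A_def by (intro sum.cong) (auto simp: npulls_upd rsum_upd)
      let ?N = "npulls (Suc t) h b" and ?S = "rsum (Suc t) h b"
      have "A (Suc t) (h(Suc t := (a, y))) = A t h + (if a = b then g ?N ?S else 0)" for y
      proof -
        have "A (Suc t) w = A t w + (if fst (w (Suc t)) = b then g (npulls (Suc t) w b) (rsum (Suc t) w b) else 0)" for w
          by (simp add: A_def)
        then show ?thesis by (simp add: old npulls_upd rsum_upd)
      qed
      moreover have "npulls (Suc (Suc t)) (h(Suc t := (a, y))) b = ?N + (if a = b then 1 else 0)"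
        "rsum (Suc (Suc t)) (h(Suc t := (a, y))) b = ?S + (if a = b then y else 0)" for y
        by (simp_all add: npulls_Suc rsum_Suc npulls_upd rsum_upd)
      ultimately have eq: "(\<integral>\<^sup>+y. A (Suc t) (h(Suc t := (a, y)))
       + V m (npulls (Suc (Suc t)) (h(Suc t := (a, y))) b) (rsum (Suc (Suc t)) (h(Suc t := (a, y))) b) \<partial>nu a)
       = (\<integral>\<^sup>+y. (A t h + (if a = b then g ?N ?S else 0)) + V m (?N + (if a = b then 1 else 0)) (?S + (if a = b then y else 0)) \<partial>nu a)"
        by simp
      show "(\<integral>\<^sup>+y. A (Suc t) (h(Suc t := (a, y)))
       + V m (npulls (Suc (Suc t)) (h(Suc t := (a, y))) b) (rsum (Suc (Suc t)) (h(Suc t := (a, y))) b) \<partial>nu a)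
        \<le> A t h + V (Suc m) ?N ?S"
      proof (cases "a = b")
        case True
        have "(\<integral>\<^sup>+y. (A t h + g ?N ?S) + V m (Suc ?N) (?S + y) \<partial>nu b)
          = (A t h + g ?N ?S) + (\<integral>\<^sup>+y. V m (Suc ?N) (?S + y) \<partial>nu b)"
          using V_meas[of m "Suc ?N"] by (subst nn_integral_add) (auto simp: emeasure_space_1)
        then show ?thesis unfolding eq V_Suc using True by (simp add: add.assoc)
      next
        \<comment> \<open>A round that pulls another arm leaves the statistics of \<open>b\<close>
          unchanged and forfeits one of the \<open>Suc m\<close> pulls in the budget.\<close>
        case False
        have "(\<integral>\<^sup>+y. A t h + V m ?N ?S \<partial>nu a) = A t h + V m ?N ?S" by (rule nn_integral_arm_const[OF a])
        then show ?thesis unfolding eq using False V_mono[of m ?N ?S] by (simp add: add_left_mono)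
      qed
    qed
    also have "\<dots> \<le> V (t + Suc m) 0 0" by (rule Suc)
    finally show ?case by simp
  qed
  then have "(\<integral>\<^sup>+h. A T h + V 0 (npulls (Suc T) h b) (rsum (Suc T) h b) \<partial>hist T) \<le> V (T + 0) 0 0" .
  then show ?thesis by (simp add: A_def V_def)
qed

end

section \<open>Regret\<close>

context klms begin

lemma pull_prob_le_walk:
  assumes b: "b \<in> {1..K}" and g: "\<And>n. g n \<in> borel_measurable borel"
  shows "(\<integral>\<^sup>+h. (\<Sum>s\<in>{1..T}. ennreal (pull_prob K s h b) * g (npulls s h b) (rsum s h b)) \<partial>hist T)
    \<le> (\<Sum>n<T. walk (nu b) n (g n) 0)"
proof -
  define \<phi> where "\<phi> s a h = (if a = b then g (npulls s h b) (rsum s h b) else 0)" for s a and h :: history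
  have "(\<Sum>a\<in>{1..K}. ennreal (pull_prob K s h a) * \<phi> s a h)
      = ennreal (pull_prob K s h b) * g (npulls s h b) (rsum s h b)" for s h
  proof -
    have "(\<Sum>a\<in>{1..K}. ennreal (pull_prob K s h a) * \<phi> s a h)
      = (\<Sum>a\<in>{1..K}. if a = b then ennreal (pull_prob K s h a) * g (npulls s h b) (rsum s h b) else 0)"
      by (intro sum.cong) (auto simp: \<phi>_def)
    then show ?thesis using b by simp
  qed
  then have "(\<integral>\<^sup>+h. (\<Sum>s\<in>{1..T}. ennreal (pull_prob K s h b) * g (npulls s h b) (rsum s h b)) \<partial>hist T)
     = (\<integral>\<^sup>+h. (\<Sum>s\<in>{1..T}. \<Sum>a\<in>{1..K}. ennreal (pull_prob K s h a) * \<phi> s a h) \<partial>hist T)" by simp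
  also have "\<dots> = (\<integral>\<^sup>+h. (\<Sum>s\<in>{1..T}. \<phi> s (fst (h s)) h) \<partial>hist T)"
  proof (rule compensator[symmetric])
    show "\<phi> s a \<in> borel_measurable (hist_space t)" if "s \<le> Suc t" for s t a
      using npulls_comp_measurable[OF that g] by (cases "a = b") (auto simp: \<phi>_def[abs_def])
    show "\<phi> s a (h(r := x)) = \<phi> s a h" if "s \<le> r" for s a h r x
      using that by (simp add: \<phi>_def npulls_upd rsum_upd)
  qed
  also have "\<dots> \<le> (\<Sum>n<T. walk (nu b) n (g n) 0)"
    unfolding \<phi>_def by (rule arm_pulls_le_walk[OF b g])
  finally show ?thesis .
qed

lemma good_statistics:
  assumes h: "good T h" "s \<le> T" and b: "b \<in> {1..K}" "K < s"
  shows "0 < npulls s h b" "0 \<le> rsum s h b" "muhat s h b \<in> {0..1}"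
proof -
  have s: "snd (h i) \<in> {0..1}" if "i \<in> {1..<s}" for i using h that by (auto simp: good_def)
  have "b \<in> {i \<in> {1..<s}. fst (h i) = b}" using h b by (auto simp: good_def)
  then show N: "0 < npulls s h b" unfolding npulls_def by (auto simp: card_gt_0_iff)
  show "0 \<le> rsum s h b" unfolding rsum_def using s by (intro sum_nonneg) auto
  moreover have "rsum s h b \<le> (\<Sum>i\<in>{1..<s}. if fst (h i) = b then 1 else 0)"
    unfolding rsum_def using s by (intro sum_mono) auto
  then have "rsum s h b \<le> real (npulls s h b)" by (simp add: npulls_eq_sum of_nat_sum if_distrib cong: if_cong)
  ultimately show "muhat s h b \<in> {0..1}" using N by (simp add: muhat_eq)
qed

text \<open>The three alternatives are: the leader is at least \<open>q\<close> and \<open>a\<close>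
  is at most \<open>p\<close>; \<open>a\<close> is overestimated; the leader is below
  \<open>q\<close>. The last one is expressed through arm 1 alone, so that its pulls can be
  charged.\<close>

lemma pull_prob_le:
  assumes h: "good T h" "s \<in> {1..T}" and a: "a \<in> {1..K}" and pq: "0 < p" "p \<le> q" "q < 1"
    and m: "0 < m" "m \<le> npulls s h a"
  shows "pull_prob K s h a \<le> exp (- (real m * kl p q)) \<or>
     p < muhat s h a \<or>
     0 < npulls s h 1 \<and> 0 \<le> rsum s h 1 \<and> rsum s h 1 \<le> real (npulls s h 1) * q \<and>
       pull_prob K s h a \<le> pull_prob K s h 1 * exp (real (npulls s h 1) * kl (muhat s h 1) q)"
proof (cases "s \<le> K")
  case True
  \<comment> \<open>In the initial phase arm \<open>a\<close> is drawn in round \<open>a\<close>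
    only, when it has no earlier pull, against \<open>0 < m\<close>.\<close>
  have "a \<noteq> s"
  proof
    assume "a = s"
    then have empty: "{i \<in> {1..<s}. fst (h i) = a} = {}" using h True by (auto simp: good_def)
    show False using m unfolding npulls_def empty by simp
  qed
  then show ?thesis using True by (simp add: pull_prob_def)
next
  case False
  define M where "M = muhat_max K s h"
  define W where "W b = klms_weight K s h b" for b
  define Z where "Z = (\<Sum>b\<in>{1..K}. W b)"
  have one: "1 \<in> {1..K}" using K by simp
  have st: "0 < npulls s h b" "0 \<le> rsum s h b" "muhat s h b \<in> {0..1}" if "b \<in> {1..K}" for b
    using good_statistics[of T h s b] h that False by auto
  have Z: "1 \<le> Z" unfolding Z_def W_def by (rule one_le_sum_klms_weight[OF K])
  have prob_eq: "pull_prob K s h b = W b / Z" for b using False by (simp add: pull_prob_def W_def Z_def)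
  have M_in: "M \<in> muhat s h ` {1..K}"
    unfolding M_def muhat_max_def using K by (intro Max_in) auto
  then have M01: "M \<in> {0..1}" using st by auto
  have le_M: "muhat s h b \<le> M" if "b \<in> {1..K}" for b
    unfolding M_def muhat_max_def using that by (intro Max_ge) auto
  have W_eq: "W b = exp (- (real (npulls s h b) * kl (muhat s h b) M))" if "b \<in> {1..K}" "M < 1" for b
    using le_M[of b] st[of b] that M01 by (auto simp: W_def klms_weight_def kl_infinite_def M_def[symmetric])
  show ?thesis
  proof (cases "muhat s h a \<le> p")
    case le_p: True
    show ?thesis
    proof (cases "q \<le> M")
      case qM: True
      have "W a \<le> exp (- (real m * kl p q))"
      proof (cases "M = 1")
        case True
        \<comment> \<open>The empirical mean of \<open>a\<close> is at most \<open>p < 1\<close>, so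
          its divergence from 1 is infinite.\<close>
        then have "W a = 0" using le_p pq by (simp add: W_def klms_weight_def kl_infinite_def M_def[symmetric])
        then show ?thesis by simp
      next
        case False
        then have M1: "M < 1" using M01 by simp
        have "kl p q \<le> kl p M" using qM M1 pq by (intro kl_mono_right) auto
        also have "\<dots> \<le> kl (muhat s h a) M"
          using st(3)[OF a] le_p pq qM M1 by (intro kl_antimono_left) auto
        finally have k: "kl p q \<le> kl (muhat s h a) M" .
        have "0 \<le> kl p q" using pq by (intro kl_nonneg) auto
        then have "real m * kl p q \<le> real (npulls s h a) * kl (muhat s h a) M"
          using k m by (intro mult_mono) auto
        then show ?thesis using W_eq[OF a M1] by simp
      qed
      moreover have "W a / Z \<le> W a"
        using Z divide_left_mono[of 1 Z "W a"] klms_weight_nonneg[of K s h a] by (simp add: W_def)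
      ultimately show ?thesis by (simp add: prob_eq)
    next
      case False
      then have Mq: "M < q" "M < 1" using pq by auto
      have "0 \<le> kl (muhat s h a) M"
      proof (cases "M = 0")
        case True
        then show ?thesis using le_M[OF a] st(3)[OF a] by simp
      qed (use st(3)[OF a] Mq M01 in \<open>auto intro!: kl_nonneg\<close>)
      then have "W a \<le> 1" using W_eq[OF a Mq(2)] by simp
      \<comment> \<open>Raising the second argument from the leader's mean to \<open>q\<close> only
        increases the divergence of arm 1, so the exponential compensates for its weight.\<close>
      moreover have "1 \<le> W 1 * exp (real (npulls s h 1) * kl (muhat s h 1) q)"
      proof -
        have "kl (muhat s h 1) M \<le> kl (muhat s h 1) q"
          using st(3)[OF one] le_M[OF one] Mq pq by (intro kl_mono_right) auto
        then have "real (npulls s h 1) * kl (muhat s h 1) M \<le> real (npulls s h 1) * kl (muhat s h 1) q"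
          by (intro mult_left_mono) auto
        then show ?thesis unfolding W_eq[OF one Mq(2)] by (simp flip: exp_add)
      qed
      ultimately have "W a / Z \<le> W 1 * exp (real (npulls s h 1) * kl (muhat s h 1) q) / Z"
        using Z by (intro divide_right_mono) auto
      moreover have "rsum s h 1 \<le> real (npulls s h 1) * q"
      proof -
        have "rsum s h 1 / real (npulls s h 1) \<le> q"
          using le_M[OF one] Mq unfolding muhat_eq by simp
        then show ?thesis using st(1)[OF one] by (simp add: divide_le_eq mult.commute)
      qed
      ultimately show ?thesis using st[OF one] by (simp add: prob_eq)
    qed
  qed auto
qed

text \<open>The first \<open>m\<close> pulls are paid in full. For later ones, the alternatives of
  \<open>pull_prob_le\<close> cost \<open>T * exp (- m * k)\<close>, an upper tail of
  \<open>a\<close> with constant 4 and the weighted lower tail of arm 1 with constant 18.\<close>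

lemma expected_pulls_le:
  fixes a :: nat and \<epsilon> v :: real
  defines "\<mu>1 \<equiv> arm_mean nu 1" and "\<mu>a \<equiv> arm_mean nu a"
  defines "k \<equiv> kl (\<mu>a + \<epsilon>) (\<mu>1 - \<epsilon>)"
  assumes a: "a \<in> {1..K}" and \<epsilon>: "0 < \<epsilon>" "\<epsilon> \<le> \<mu>1 / 4" "\<mu>a + \<epsilon> \<le> \<mu>1 - \<epsilon>"
    and v: "\<mu>1 * (1 - \<mu>1) + (\<mu>1 - \<mu>a) \<le> v" and m: "0 < m"
  shows "(\<integral>\<^sup>+h. of_nat (npulls (Suc T) h a) \<partial>hist T)
     \<le> ennreal (real m + real T * exp (- (real m * k)) + 22 * v / \<epsilon>\<^sup>2)"
proof -
  define p where "p = \<mu>a + \<epsilon>"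
  define q where "q = \<mu>1 - \<epsilon>"
  have one: "1 \<in> {1..K}" using K by simp
  interpret A1: unit_prob "nu 1" using arm[OF one] .
  interpret Aa: unit_prob "nu a" using arm[OF a] .
  have \<mu>1: "\<mu>1 \<in> {0..1}" and \<mu>a: "\<mu>a \<in> {0..1}"
    using A1.mean_unit Aa.mean_unit by (auto simp: \<mu>1_def \<mu>a_def arm_mean_def)
  have pq: "0 < p" "p \<le> q" "q < 1" using \<mu>1 \<mu>a \<epsilon> by (auto simp: p_def q_def)
  \<comment> \<open>The index \<open>n = 0\<close> is excluded because the tail condition reads
    \<open>0 <= 0\<close> there. Nothing is lost, as \<open>pull_prob_le\<close> is applied when the
    arm concerned has been pulled.\<close>
  define up where "up n S = (if n = 0 then 0 else indicator {S. real n * \<epsilon> \<le> 1 * (S - real n * \<mu>a)} S :: ennreal)"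
    for n :: nat and S
  define low where "low n S = (if n = 0 then 0 else weighted_lower_tail q n S)" for n :: nat and S
  have up_meas [measurable]: "up n \<in> borel_measurable borel" for n unfolding up_def by measurable
  have low_meas [measurable]: "low n \<in> borel_measurable borel" for n
    unfolding low_def weighted_lower_tail_def by measurable
  have drop0: "(\<Sum>n<T. walk \<nu> n (\<lambda>S. if n = 0 then 0 else f n S) 0) = (\<Sum>n\<in>{1..<T}. walk \<nu> n (f n) 0)"
    for \<nu> and f :: "nat \<Rightarrow> real \<Rightarrow> ennreal"
  proof -
    have "(\<Sum>n<T. walk \<nu> n (\<lambda>S. if n = 0 then 0 else f n S) 0)
       = (\<Sum>n\<in>{1..<T}. walk \<nu> n (\<lambda>S. if n = 0 then 0 else f n S) 0)"
      by (intro sum.mono_neutral_right) (auto simp: Suc_le_eq)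
    also have "\<dots> = (\<Sum>n\<in>{1..<T}. walk \<nu> n (f n) 0)"
      by (intro sum.cong) auto
    finally show ?thesis .
  qed
  \<comment> \<open>The variance \<open>x * (1 - x)\<close> has slope between -1 and 1, so on this
    interval it exceeds \<open>\<mu>1 * (1 - \<mu>1)\<close> by at most the gap.\<close>
  have var: "x * (1 - x) \<le> v" if "\<mu>a \<le> x" "x \<le> \<mu>1" for x
  proof -
    have "(\<mu>1 - x) * (1 - x - \<mu>1) \<ge> (\<mu>1 - x) * (- 1)"
      using that \<mu>1 \<mu>a by (intro mult_left_mono) auto
    then show ?thesis using v that by (simp add: algebra_simps)
  qed
  have v0: "\<epsilon> \<le> v" "0 \<le> v"
  proof -
    have "0 \<le> \<mu>1 * (1 - \<mu>1)" using \<mu>1 by simp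
    then show "\<epsilon> \<le> v" using v \<epsilon> by linarith
    then show "0 \<le> v" using \<epsilon> by simp
  qed
  have upper: "(\<Sum>n<T. walk (nu a) n (up n) 0) \<le> ennreal (4 * v / \<epsilon>\<^sup>2)"
    unfolding up_def drop0
    using Aa.tail_sum_le[of 1 \<epsilon> v T] \<epsilon> v0 var[of \<mu>a] by (auto simp: \<mu>a_def arm_mean_def)
  have lower: "(\<Sum>n<T. walk (nu 1) n (low n) 0) \<le> ennreal (18 * v / \<epsilon>\<^sup>2)"
    unfolding low_def drop0
    using A1.weighted_lower_tail_sum_le[of q v T] \<epsilon> v pq by (auto simp: \<mu>1_def q_def arm_mean_def)
  define \<phi> where "\<phi> s b h = (if b = a \<and> m \<le> npulls s h a then 1 else 0 :: ennreal)" for s b h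
  have count: "of_nat (npulls (Suc T) h a) \<le> of_nat m + (\<Sum>s\<in>{1..T}. \<phi> s (fst (h s)) h)" for h
  proof (induction T)
    case 0 then show ?case by (simp add: npulls_def)
  next
    case (Suc T)
    show ?case
    proof (cases "fst (h (Suc T)) = a \<and> \<not> m \<le> npulls (Suc T) h a")
      case True
      then have "npulls (Suc (Suc T)) h a \<le> m" by (simp add: npulls_Suc)
      then have "(of_nat (npulls (Suc (Suc T)) h a) :: ennreal) \<le> of_nat m" by simp
      then show ?thesis by (rule order_trans) simp
    next
      case False
      then have "(of_nat (npulls (Suc (Suc T)) h a) :: ennreal) = of_nat (npulls (Suc T) h a) + \<phi> (Suc T) (fst (h (Suc T))) h"
        by (auto simp: npulls_Suc \<phi>_def add.commute)
      then show ?thesis using add_right_mono[OF Suc] by (simp add: add.assoc)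
    qed
  qed
  have npred: "{h \<in> space (hist_space t). m \<le> npulls s h a} \<in> sets (hist_space t)" if "s \<le> Suc t" for s t
    using npulls_measurable[OF that, of a] by measurable
  have \<phi>_meas: "\<phi> s b \<in> borel_measurable (hist_space t)" if "s \<le> Suc t" for s b t
    using npred[OF that] by (cases "b = a") (auto simp: \<phi>_def[abs_def])
  let ?P = "\<lambda>s h b. ennreal (pull_prob K s h b)"
  let ?U = "\<lambda>s h. ?P s h a * up (npulls s h a) (rsum s h a)"
  let ?L = "\<lambda>s h. ?P s h 1 * low (npulls s h 1) (rsum s h 1)"
  let ?e = "ennreal (exp (- (real m * k)))"
  have pointwise: "(\<Sum>b\<in>{1..K}. ?P s h b * \<phi> s b h) \<le> ?e + ?U s h + ?L s h"
    if h: "good T h" and s: "s \<in> {1..T}" for s h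
  proof -
    have "(\<Sum>b\<in>{1..K}. ?P s h b * \<phi> s b h) = (\<Sum>b\<in>{1..K}. if b = a then ?P s h a * \<phi> s a h else 0)"
      by (intro sum.cong) (auto simp: \<phi>_def)
    also have "\<dots> = ?P s h a * \<phi> s a h" using a by simp
    also have "\<dots> \<le> ?e + ?U s h + ?L s h"
    proof (cases "m \<le> npulls s h a")
      case True
      then have N: "0 < npulls s h a" using m by simp
      from pull_prob_le[OF h s a pq m True] show ?thesis
      proof (elim disjE conjE)
        assume "pull_prob K s h a \<le> exp (- (real m * kl p q))"
        then have "?P s h a \<le> ?e" by (simp add: k_def p_def q_def ennreal_leI)
        then show ?thesis using True by (simp add: \<phi>_def add.assoc add_increasing2)
      next
        assume "p < muhat s h a"
        then have "up (npulls s h a) (rsum s h a) = 1"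
          using N by (simp add: up_def muhat_eq p_def field_simps)
        then show ?thesis using True by (simp add: \<phi>_def add_increasing add_increasing2)
      next
        assume *: "0 < npulls s h 1" "0 \<le> rsum s h 1" "rsum s h 1 \<le> real (npulls s h 1) * q"
          "pull_prob K s h a \<le> pull_prob K s h 1 * exp (real (npulls s h 1) * kl (muhat s h 1) q)"
        then have "?P s h a \<le> ?L s h"
          by (simp add: low_def weighted_lower_tail_def muhat_eq ennreal_leI pull_prob_nonneg flip: ennreal_mult)
        then show ?thesis using True by (simp add: \<phi>_def add_increasing)
      qed
    qed (simp add: \<phi>_def)
    finally show ?thesis .
  qed
  have U_meas: "?U s \<in> borel_measurable (hist_space T)" and L_meas: "?L s \<in> borel_measurable (hist_space T)"
    if "s \<in> {1..T}" for s
    using that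
    by (auto intro!: borel_measurable_times_ennreal measurable_compose[OF pull_prob_measurable measurable_ennreal]
        npulls_comp_measurable)
  have "(\<integral>\<^sup>+h. of_nat (npulls (Suc T) h a) \<partial>hist T) \<le> (\<integral>\<^sup>+h. of_nat m + (\<Sum>s\<in>{1..T}. \<phi> s (fst (h s)) h) \<partial>hist T)"
    by (intro nn_integral_mono count)
  also have "\<dots> = of_nat m + (\<integral>\<^sup>+h. (\<Sum>s\<in>{1..T}. \<phi> s (fst (h s)) h) \<partial>hist T)"
  proof -
    have "(\<lambda>h. \<phi> s (fst (h s)) h) \<in> borel_measurable (hist_space T)" if "s \<in> {1..T}" for s
      by (rule measurable_compose_countable[where f = "\<lambda>b h. \<phi> s b h" and g = "\<lambda>h. fst (h s)"])
        (use that in \<open>auto intro!: \<phi>_meas fst_measurable_hist\<close>)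
    then show ?thesis
      by (subst nn_integral_add) (auto simp: hist.emeasure_space_1[simplified])
  qed
  also have "(\<integral>\<^sup>+h. (\<Sum>s\<in>{1..T}. \<phi> s (fst (h s)) h) \<partial>hist T)
     = (\<integral>\<^sup>+h. (\<Sum>s\<in>{1..T}. \<Sum>b\<in>{1..K}. ?P s h b * \<phi> s b h) \<partial>hist T)"
    by (rule compensator[OF \<phi>_meas]) (auto simp: \<phi>_def npulls_upd)
  also have "\<dots> \<le> (\<integral>\<^sup>+h. (\<Sum>s\<in>{1..T}. ?e + ?U s h + ?L s h) \<partial>hist T)"
    using AE_good[of T] by (intro nn_integral_mono_AE, eventually_elim) (intro sum_mono pointwise, auto)
  also have "\<dots> = (\<integral>\<^sup>+h. (of_nat T * ?e + (\<Sum>s\<in>{1..T}. ?U s h)) + (\<Sum>s\<in>{1..T}. ?L s h) \<partial>hist T)"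
    by (simp add: sum.distrib)
  also have "\<dots> = of_nat T * ?e + (\<integral>\<^sup>+h. (\<Sum>s\<in>{1..T}. ?U s h) \<partial>hist T) + (\<integral>\<^sup>+h. (\<Sum>s\<in>{1..T}. ?L s h) \<partial>hist T)"
  proof -
    have "(\<lambda>h. \<Sum>s\<in>{1..T}. ?U s h) \<in> borel_measurable (hist T)" "(\<lambda>h. \<Sum>s\<in>{1..T}. ?L s h) \<in> borel_measurable (hist T)"
      unfolding measurable_cong_sets[OF sets_hist refl] by (intro borel_measurable_sum U_meas L_meas; assumption)+
    note [measurable] = this
    show ?thesis by (subst nn_integral_add, measurable, subst nn_integral_add, measurable)
       (simp add: hist.emeasure_space_1[simplified])
  qed
  also have "\<dots> \<le> of_nat T * ?e + ennreal (4 * v / \<epsilon>\<^sup>2) + ennreal (18 * v / \<epsilon>\<^sup>2)"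
    by (intro add_mono order_refl order_trans[OF pull_prob_le_walk[OF a up_meas] upper]
        order_trans[OF pull_prob_le_walk[OF one low_meas] lower])
  finally have "(\<integral>\<^sup>+h. of_nat (npulls (Suc T) h a) \<partial>hist T)
     \<le> of_nat m + (of_nat T * ?e + ennreal (4 * v / \<epsilon>\<^sup>2) + ennreal (18 * v / \<epsilon>\<^sup>2))"
    by (simp add: add_left_mono)
  also have "\<dots> = ennreal (real m) + (ennreal (real T) * ?e + (ennreal (4 * v / \<epsilon>\<^sup>2) + ennreal (18 * v / \<epsilon>\<^sup>2)))"
    by (simp add: ennreal_of_nat_eq_real_of_nat add.assoc)
  also have "ennreal (4 * v / \<epsilon>\<^sup>2) + ennreal (18 * v / \<epsilon>\<^sup>2) = ennreal (22 * v / \<epsilon>\<^sup>2)"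
    using v0 by (subst ennreal_plus[symmetric]) (auto simp: add_divide_distrib[symmetric])
  also have "ennreal (real m) + (ennreal (real T) * ?e + ennreal (22 * v / \<epsilon>\<^sup>2))
     = ennreal (real m + real T * exp (- (real m * k)) + 22 * v / \<epsilon>\<^sup>2)"
    using v0 by (simp add: ennreal_mult ennreal_plus add.assoc)
  finally show ?thesis .
qed

lemma regret_le:
  assumes opt: "\<And>b. b \<in> {1..K} \<Longrightarrow> arm_mean nu b \<le> arm_mean nu 1" and "0 \<le> \<Delta>"
    and B: "\<And>a. \<lbrakk>a \<in> {1..K}; \<Delta> < arm_mean nu 1 - arm_mean nu a\<rbrakk> \<Longrightarrow>
        0 \<le> B a \<and> (\<integral>\<^sup>+h. of_nat (npulls (Suc T) h a) \<partial>hist T) \<le> ennreal (B a)"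
  shows "klms_regret nu K T \<le> real T * \<Delta>
     + (\<Sum>a\<in>{a\<in>{1..K}. \<Delta> < arm_mean nu 1 - arm_mean nu a}. (arm_mean nu 1 - arm_mean nu a) * B a)"
proof -
  define A where "A = {a\<in>{1..K}. \<Delta> < arm_mean nu 1 - arm_mean nu a}"
  define gap where "gap a = arm_mean nu 1 - arm_mean nu a" for a
  define R where "R = (\<integral>h. (\<Sum>t\<in>{1..T}. snd (h t)) \<partial>hist T)"
  have A: "finite A" "\<And>a. a \<in> A \<Longrightarrow> a \<in> {1..K} \<and> \<Delta> < gap a" by (auto simp: A_def gap_def)
  have mean: "0 \<le> arm_mean nu b" if "b \<in> {1..K}" for b
  proof -
    interpret unit_prob "nu b" using arm[OF that] .
    show ?thesis using mean_unit by (simp add: arm_mean_def)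
  qed
  have N_meas [measurable]: "(\<lambda>h. npulls (Suc T) h a) \<in> measurable (hist T) (count_space UNIV)" for a
    unfolding measurable_cong_sets[OF sets_hist refl] by (rule npulls_measurable) simp
  have means_meas [measurable]:
    "(\<lambda>h. \<Sum>s\<in>{1..T}. ennreal (arm_mean nu (fst (h s)))) \<in> borel_measurable (hist T)"
    unfolding measurable_cong_sets[OF sets_hist refl] by measurable
  have int: "integrable (hist T) (\<lambda>h. \<Sum>t\<in>{1..T}. snd (h t))"
  proof (rule hist.integrable_const_bound)
    show "AE h in hist T. norm (\<Sum>t\<in>{1..T}. snd (h t)) \<le> real T"
      using AE_good
    proof eventually_elim
      case (elim h)
      have "norm (\<Sum>t\<in>{1..T}. snd (h t)) \<le> (\<Sum>t\<in>{1..T}. 1)"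
        using elim by (intro sum_norm_le) (auto simp: good_def)
      then show ?case by simp
    qed
  qed (use snd_measurable_hist in \<open>auto simp: measurable_cong_sets[OF sets_hist refl] intro!: borel_measurable_sum\<close>)
  have R_nonneg: "AE h in hist T. 0 \<le> (\<Sum>t\<in>{1..T}. snd (h t))"
    using AE_good by eventually_elim (auto simp: good_def intro!: sum_nonneg)
  have R: "ennreal R = (\<integral>\<^sup>+h. (\<Sum>s\<in>{1..T}. ennreal (arm_mean nu (fst (h s)))) \<partial>hist T)"
  proof -
    have "ennreal R = (\<integral>\<^sup>+h. ennreal (\<Sum>t\<in>{1..T}. snd (h t)) \<partial>hist T)"
      unfolding R_def by (rule nn_integral_eq_integral[symmetric, OF int R_nonneg])
    also have "\<dots> = (\<integral>\<^sup>+h. (\<Sum>t\<in>{1..T}. ennreal (snd (h t))) \<partial>hist T)"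
      using AE_good by (intro nn_integral_cong_AE, eventually_elim) (subst sum_ennreal, auto simp: good_def)
    finally show ?thesis unfolding reward_sum .
  qed
  have R0: "0 \<le> R" unfolding R_def by (rule integral_nonneg_AE[OF R_nonneg])
  \<comment> \<open>Arms with gap at most \<open>\<Delta>\<close> cost at most
    \<open>\<Delta>\<close> per round. The reward \<open>R\<close> stays on the right side, so that
    only nonnegative quantities are added and the comparison can be made in
    \<open>ennreal\<close>.\<close>
  define tot where "tot = real T * \<Delta> + (\<Sum>a\<in>A. gap a * B a)"
  have tot0: "0 \<le> tot" unfolding tot_def
    using assms(2) A B by (intro add_nonneg_nonneg sum_nonneg mult_nonneg_nonneg) (fastforce simp: gap_def)+
  have pt: "ennreal (real T * arm_mean nu 1) \<le>
      (ennreal (real T * \<Delta>) + (\<Sum>a\<in>A. ennreal (gap a) * of_nat (npulls (Suc T) h a)))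
       + (\<Sum>s\<in>{1..T}. ennreal (arm_mean nu (fst (h s))))" if h: "good T h" for h
  proof -
    have arms: "fst (h s) \<in> {1..K}" if "s \<in> {1..T}" for s using h that by (auto simp: good_def)
    have "real T * arm_mean nu 1 = (\<Sum>s\<in>{1..T}. gap (fst (h s))) + (\<Sum>s\<in>{1..T}. arm_mean nu (fst (h s)))"
      by (simp add: gap_def sum_subtractf)
    also have "(\<Sum>s\<in>{1..T}. gap (fst (h s))) \<le> (\<Sum>s\<in>{1..T}. \<Delta> + (\<Sum>a\<in>A. if fst (h s) = a then gap a else 0))"
      using arms A assms(2) by (intro sum_mono) (auto simp: A_def gap_def not_less)
    also have "\<dots> = real T * \<Delta> + (\<Sum>s\<in>{1..T}. \<Sum>a\<in>A. if fst (h s) = a then gap a else 0)"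
      by (simp add: sum.distrib)
    also have "(\<Sum>s\<in>{1..T}. \<Sum>a\<in>A. if fst (h s) = a then gap a else 0)
        = (\<Sum>a\<in>A. \<Sum>s\<in>{1..T}. if fst (h s) = a then gap a else 0)" by (rule sum.swap)
    also have "\<dots> = (\<Sum>a\<in>A. gap a * real (npulls (Suc T) h a))"
      by (simp add: npulls_eq_sum of_nat_sum sum_distrib_left if_distrib atLeastLessThanSuc_atLeastAtMost cong: if_cong)
    finally have "ennreal (real T * arm_mean nu 1) \<le> ennreal (real T * \<Delta> + (\<Sum>a\<in>A. gap a * real (npulls (Suc T) h a))
       + (\<Sum>s\<in>{1..T}. arm_mean nu (fst (h s))))" by (simp add: ennreal_leI)
    also have "\<dots> = (ennreal (real T * \<Delta>) + (\<Sum>a\<in>A. ennreal (gap a) * of_nat (npulls (Suc T) h a)))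
       + (\<Sum>s\<in>{1..T}. ennreal (arm_mean nu (fst (h s))))"
    proof -
      have g0: "0 \<le> gap a" if "a \<in> A" for a using A(2)[OF that] assms(2) by simp
      have "(\<Sum>a\<in>A. ennreal (gap a) * of_nat (npulls (Suc T) h a)) = ennreal (\<Sum>a\<in>A. gap a * real (npulls (Suc T) h a))"
        using g0 by (subst sum_ennreal[symmetric]) (auto simp: ennreal_mult ennreal_of_nat_eq_real_of_nat intro!: sum.cong)
      moreover have "(\<Sum>s\<in>{1..T}. ennreal (arm_mean nu (fst (h s)))) = ennreal (\<Sum>s\<in>{1..T}. arm_mean nu (fst (h s)))"
        using arms mean by (intro sum_ennreal) auto
      moreover have "0 \<le> (\<Sum>a\<in>A. gap a * real (npulls (Suc T) h a))"
        using g0 by (intro sum_nonneg) auto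
      moreover have "0 \<le> (\<Sum>s\<in>{1..T}. arm_mean nu (fst (h s)))"
        using arms mean by (intro sum_nonneg) auto
      ultimately show ?thesis using assms(2) by simp
    qed
    finally show ?thesis .
  qed
  have "ennreal (real T * arm_mean nu 1) = (\<integral>\<^sup>+h. ennreal (real T * arm_mean nu 1) \<partial>hist T)"
    by (simp add: hist.emeasure_space_1[simplified])
  also have "\<dots> \<le> (\<integral>\<^sup>+h. (ennreal (real T * \<Delta>) + (\<Sum>a\<in>A. ennreal (gap a) * of_nat (npulls (Suc T) h a)))
       + (\<Sum>s\<in>{1..T}. ennreal (arm_mean nu (fst (h s)))) \<partial>hist T)"
    using AE_good[of T] by (intro nn_integral_mono_AE, eventually_elim) (rule pt)
  also have "\<dots> = (\<integral>\<^sup>+h. (ennreal (real T * \<Delta>) + (\<Sum>a\<in>A. ennreal (gap a) * of_nat (npulls (Suc T) h a))) \<partial>hist T) + ennreal R"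
    unfolding R by (rule nn_integral_add) measurable
  finally have main: "ennreal (real T * arm_mean nu 1) \<le>
    (\<integral>\<^sup>+h. (ennreal (real T * \<Delta>) + (\<Sum>a\<in>A. ennreal (gap a) * of_nat (npulls (Suc T) h a))) \<partial>hist T) + ennreal R" .
  have "(\<integral>\<^sup>+h. (ennreal (real T * \<Delta>) + (\<Sum>a\<in>A. ennreal (gap a) * of_nat (npulls (Suc T) h a))) \<partial>hist T)
     = ennreal (real T * \<Delta>) + (\<Sum>a\<in>A. ennreal (gap a) * (\<integral>\<^sup>+h. of_nat (npulls (Suc T) h a) \<partial>hist T))"
    by (subst nn_integral_add, simp, simp, subst nn_integral_sum, simp)
      (simp add: nn_integral_cmult hist.emeasure_space_1[simplified])
  also have "\<dots> \<le> ennreal (real T * \<Delta>) + (\<Sum>a\<in>A. ennreal (gap a) * ennreal (B a))"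
    using B A by (intro add_mono sum_mono mult_left_mono) (auto simp: gap_def)
  also have "\<dots> = ennreal tot"
  proof -
    have g0: "0 \<le> gap a \<and> 0 \<le> B a" if "a \<in> A" for a using A(2)[OF that] B[of a] assms(2) by (simp add: gap_def)
    have "(\<Sum>a\<in>A. ennreal (gap a) * ennreal (B a)) = ennreal (\<Sum>a\<in>A. gap a * B a)"
      using g0 by (subst sum_ennreal[symmetric]) (auto simp: ennreal_mult intro!: sum.cong)
    then show ?thesis unfolding tot_def using assms(2) g0 by (subst ennreal_plus) (auto intro!: sum_nonneg)
  qed
  finally have "ennreal (real T * arm_mean nu 1) \<le> ennreal tot + ennreal R"
    using main add_right_mono order_trans by blast
  also have "ennreal tot + ennreal R = ennreal (tot + R)" using tot0 R0 by simp
  finally have "real T * arm_mean nu 1 \<le> tot + R"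
    using tot0 R0 by (subst (asm) ennreal_le_iff) auto
  then show ?thesis unfolding klms_regret_def R_def[symmetric] tot_def A_def gap_def by simp
qed

end

section \<open>Choice of the threshold and collection of the constants\<close>

theorem theorem1:
  fixes nu :: "nat \<Rightarrow> real measure" and K T :: nat and \<Delta> c :: real
  assumes K2: "K \<ge> 2"
    and prob: "\<And>a. a \<in> {1..K} \<Longrightarrow> prob_space (nu a)"
    and borel: "\<And>a. a \<in> {1..K} \<Longrightarrow> sets (nu a) = sets borel"
    and supp: "\<And>a. a \<in> {1..K} \<Longrightarrow> emeasure (nu a) {0..1} = 1"
    and sorted: "\<And>a b. 1 \<le> a \<Longrightarrow> a \<le> b \<Longrightarrow> b \<le> K \<Longrightarrow> arm_mean nu b \<le> arm_mean nu a"
    and Delta: "\<Delta> \<ge> 0"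
    and c: "0 < c" "c \<le> 1/4"
  shows "klms_regret nu K T \<le>
      real T * \<Delta>
      + (\<Sum>a\<in>{a\<in>{1..K}. arm_mean nu 1 - arm_mean nu a > \<Delta>}.
           let \<mu>1 = arm_mean nu 1; \<Delta>a = \<mu>1 - arm_mean nu a;
               k = kl (arm_mean nu a + c * \<Delta>a) (\<mu>1 - c * \<Delta>a)
           in \<Delta>a * ln (max (real T * k) (exp 2)) / k)
      + 392 * (\<Sum>a\<in>{a\<in>{1..K}. arm_mean nu 1 - arm_mean nu a > \<Delta>}.
           let \<mu>1 = arm_mean nu 1; \<Delta>a = \<mu>1 - arm_mean nu a; d = \<mu>1 * (1 - \<mu>1)
           in ((d + \<Delta>a) / (c\<^sup>2 * \<Delta>a))
              * ln (max (min ((d + \<Delta>a) / (c\<^sup>2 * \<Delta>a\<^sup>2)) (c\<^sup>2 * real T * \<Delta>a\<^sup>2 / (d + \<Delta>a))) (exp 2)))"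
proof -
  interpret klms nu K
  proof (rule klms.intro)
    show "1 \<le> K" using K2 by simp
    show "unit_prob (nu a)" if a: "a \<in> {1..K}" for a
    proof -
      interpret prob_space "nu a" using prob[OF a] .
      have "AE y in nu a. y \<in> {0..1}"
        using supp[OF a] borel[OF a] by (subst AE_in_set_eq_1) (auto simp: emeasure_eq_measure)
      then show ?thesis
        by (intro unit_prob.intro unit_prob_axioms.intro prob[OF a] borel[OF a])
    qed
  qed
  define \<mu>1 where "\<mu>1 = arm_mean nu 1"
  define D where "D a = \<mu>1 - arm_mean nu a" for a
  define k where "k a = kl (arm_mean nu a + c * D a) (\<mu>1 - c * D a)" for a
  define L where "L a = ln (max (real T * k a) (exp 2))" for a
  define v where "v a = \<mu>1 * (1 - \<mu>1) + D a" for a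
  \<comment> \<open>The 24 is 22 from \<open>expected_pulls_le\<close>, one for rounding
    \<open>m\<close> up and one for \<open>T * exp (- m * k) <= 1 / k\<close>; each of the latter
    two is at most \<open>v / \<epsilon>^2\<close>.\<close>
  define B where "B a = L a / k a + 24 * (v a / (c * D a)\<^sup>2)" for a
  define A where "A = {a\<in>{1..K}. arm_mean nu 1 - arm_mean nu a > \<Delta>}"
  have mean: "arm_mean nu b \<in> {0..1}" if "b \<in> {1..K}" for b
  proof -
    interpret unit_prob "nu b" using arm[OF that] .
    show ?thesis using mean_unit by (simp add: arm_mean_def)
  qed
  have \<mu>1: "\<mu>1 \<in> {0..1}" unfolding \<mu>1_def using K by (intro mean) auto
  have key: "0 \<le> B a \<and> (\<integral>\<^sup>+h. of_nat (npulls (Suc T) h a) \<partial>hist T) \<le> ennreal (B a)"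
    if a: "a \<in> {1..K}" and "\<Delta> < D a" for a
  proof -
    define \<epsilon> where "\<epsilon> = c * D a"
    have D: "0 < D a" using that Delta by simp
    have Dle: "D a \<le> \<mu>1" "D a \<le> 1" using mean[OF a] \<mu>1 by (auto simp: D_def)
    have \<epsilon>: "0 < \<epsilon>" "\<epsilon> \<le> D a / 4"
      using c D mult_right_mono[OF c(2), of "D a"] by (auto simp: \<epsilon>_def)
    have v: "D a \<le> v a" using \<mu>1 by (simp add: v_def)
    have \<epsilon>2: "16 * \<epsilon>\<^sup>2 \<le> (D a)\<^sup>2"
      using \<epsilon> power_mono[of \<epsilon> "D a / 4" 2] by (simp add: power_divide)
    have "\<epsilon>\<^sup>2 \<le> v a"
    proof -
      have "(D a)\<^sup>2 \<le> D a" using D Dle by (simp add: power2_eq_square mult_left_le)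
      then show ?thesis using \<epsilon>2 v zero_le_power2[of \<epsilon>] by linarith
    qed
    then have one: "1 \<le> v a / \<epsilon>\<^sup>2" using \<epsilon> by simp
    have k_ge: "((\<mu>1 - \<epsilon>) - (arm_mean nu a + \<epsilon>))\<^sup>2 / (2 * v a) \<le> k a"
      unfolding k_def \<epsilon>_def[symmetric]
    proof (rule kl_ge_quadratic)
      fix x assume x: "arm_mean nu a + \<epsilon> \<le> x" "x \<le> \<mu>1 - \<epsilon>"
      have "(\<mu>1 - x) * (- 1) \<le> (\<mu>1 - x) * (1 - x - \<mu>1)"
        using x \<mu>1 \<epsilon> mean[OF a] by (intro mult_left_mono) auto
      then show "x * (1 - x) \<le> v a" using x \<epsilon> by (simp add: v_def D_def algebra_simps)
    qed (use \<epsilon> mean[OF a] \<mu>1 v D in \<open>auto simp: D_def\<close>)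
    \<comment> \<open>Here \<open>c <= 1/4\<close> enters: moving both means inwards by
      \<open>\<epsilon>\<close> keeps at least half of the gap.\<close>
    have "(D a / 2)\<^sup>2 \<le> ((\<mu>1 - \<epsilon>) - (arm_mean nu a + \<epsilon>))\<^sup>2"
      using \<epsilon> D by (intro power_mono) (auto simp: D_def)
    then have "(D a)\<^sup>2 / 4 / (2 * v a) \<le> k a"
      using v D by (intro order_trans[OF _ k_ge] divide_right_mono) (auto simp: power_divide)
    then have k8: "(D a)\<^sup>2 / (8 * v a) \<le> k a" by simp
    have k: "0 < k a" by (rule less_le_trans[OF _ k8]) (use v D in auto)
    have "1 / k a \<le> 1 / ((D a)\<^sup>2 / (8 * v a))"
      using k8 k v D by (intro divide_left_mono) auto
    also have "\<dots> = 8 * v a / (D a)\<^sup>2" by simp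
    also have "\<dots> \<le> 8 * v a / (16 * \<epsilon>\<^sup>2)"
      using \<epsilon>2 \<epsilon> v D by (intro divide_left_mono) auto
    also have "\<dots> = v a / \<epsilon>\<^sup>2 / 2" by simp
    also have "\<dots> \<le> v a / \<epsilon>\<^sup>2"
    proof -
      have "x / 2 \<le> x" if "1 \<le> x" for x :: real using that by simp
      from this[OF one] show ?thesis .
    qed
    finally have inv_k: "1 / k a \<le> v a / \<epsilon>\<^sup>2" .
    have L: "2 \<le> L a"
      unfolding L_def by (subst ln_ge_iff) (auto simp: less_max_iff_disj)
    \<comment> \<open>The least integer with \<open>m * k >= L\<close>; then
      \<open>T * exp (- m * k)\<close> is at most \<open>T / max (T * k) (exp 2)\<close>, hence at
      most \<open>1 / k\<close>.\<close>
    define m where "m = nat \<lceil>L a / k a\<rceil>"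
    have Lk: "0 < L a / k a" using L k by simp
    then have m: "0 < m" "L a / k a \<le> real m" "real m \<le> L a / k a + 1"
      unfolding m_def by linarith+
    have "real T * exp (- (real m * k a)) \<le> 1 / k a"
    proof -
      have "L a \<le> real m * k a" using m(2) k by (simp add: divide_le_eq)
      then have "real T * exp (- (real m * k a)) \<le> real T * exp (- L a)"
        by (intro mult_left_mono) auto
      also have "exp (- L a) = 1 / max (real T * k a) (exp 2)"
        by (simp add: L_def exp_minus less_max_iff_disj field_simps)
      also have "real T * (1 / max (real T * k a) (exp 2)) \<le> 1 / k a"
      proof (cases "T = 0")
        case False
        then have "real T / max (real T * k a) (exp 2) \<le> real T / (real T * k a)"
          using k by (intro divide_left_mono) (auto simp: less_max_iff_disj)
        then show ?thesis using False by simp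
      qed (use k in simp)
      finally show ?thesis .
    qed
    then have "real m + real T * exp (- (real m * k a)) + 22 * v a / \<epsilon>\<^sup>2 \<le> B a"
      using m(3) one inv_k by (simp add: B_def \<epsilon>_def[symmetric])
    moreover have "(\<integral>\<^sup>+h. of_nat (npulls (Suc T) h a) \<partial>hist T)
      \<le> ennreal (real m + real T * exp (- (real m * k a)) + 22 * v a / \<epsilon>\<^sup>2)"
      unfolding k_def \<epsilon>_def[symmetric] \<mu>1_def
      by (rule expected_pulls_le[OF a]) (use \<epsilon> D Dle m in \<open>auto simp: D_def v_def \<mu>1_def\<close>)
    moreover have "0 \<le> B a" unfolding B_def using Lk v D by simp
    ultimately show ?thesis by (meson ennreal_leI order_trans)
  qed
  have term_le: "D a * B a \<le> D a * L a / k a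
      + 392 * ((v a / (c\<^sup>2 * D a)) * ln (max (min (v a / (c\<^sup>2 * (D a)\<^sup>2)) (c\<^sup>2 * real T * (D a)\<^sup>2 / v a)) (exp 2)))"
    if "a \<in> A" for a
  proof -
    have D: "0 < D a" using that Delta by (simp add: A_def D_def \<mu>1_def)
    have v: "0 < v a" using D \<mu>1 by (simp add: v_def add_nonneg_pos)
    define r where "r = v a / (c\<^sup>2 * D a)"
    have r: "0 < r" using v D c by (simp add: r_def)
    have "D a * (24 * (v a / (c * D a)\<^sup>2)) = 24 * r"
      using D by (simp add: r_def power2_eq_square)
    \<comment> \<open>The 2 stands for the logarithm, whose argument is at least
      \<open>exp 2\<close>.\<close>
    also have "\<dots> \<le> 392 * (r * 2)" using r by simp
    also have "\<dots> \<le> 392 * (r * ln (max (min (v a / (c\<^sup>2 * (D a)\<^sup>2)) (c\<^sup>2 * real T * (D a)\<^sup>2 / v a)) (exp 2)))"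
      using r by (intro mult_left_mono) (auto simp: ln_ge_iff less_max_iff_disj)
    finally show ?thesis by (simp add: B_def r_def distrib_left)
  qed
  have "klms_regret nu K T \<le> real T * \<Delta> + (\<Sum>a\<in>A. D a * B a)"
    unfolding A_def D_def \<mu>1_def
    by (rule regret_le) (use sorted Delta key in \<open>auto simp: D_def \<mu>1_def\<close>)
  also have "\<dots> \<le> real T * \<Delta> + (\<Sum>a\<in>A. D a * L a / k a
      + 392 * ((v a / (c\<^sup>2 * D a)) * ln (max (min (v a / (c\<^sup>2 * (D a)\<^sup>2)) (c\<^sup>2 * real T * (D a)\<^sup>2 / v a)) (exp 2))))"
    by (intro add_left_mono sum_mono term_le)
  finally show ?thesis
    by (simp add: Let_def sum.distrib sum_distrib_left A_def L_def k_def v_def D_def \<mu>1_def add.assoc)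
qed

end
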